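(* Let $\mathfrak A$ be a measured regular multiplier Hopf algebroid (with total algebra $A$) and let $\mathfrak A'$ be its dual, with total algebra $A'=\widehat A$. Then the pairing $\langle a,\omega\rangle=\omega(a)$ of the underlying algebras $A$ and $A'$ yields a pairing of regular multiplier Hopf algebroids between $\mathfrak A$ and $\mathfrak A'$.
   Context: CONVENTIONS. Algebras are associative over $\mathbb C$, not necessarily unital, with non-degenerate product. $M(A)$ is the multiplier algebra, $\iota$ an identity map. $A$ is idempotent if it is spanned by products. A functional $\omega$ on an algebra $D$ is faithful if $\omega(dd')=0$ for all $d$ implies $d'=0$ and $\omega(d'd)=0$ for all $d$ implies $d'=0$. Primed symbols denote the corresponding objects for $A'$, $\mathfrak A'$. REGULAR MULTIPLIER HOPF ALGEBROIDS. Such an object is a tuple $\mathfrak A=(A,B,C,t_B,t_C,\Delta_B,\Delta_C)$: $A$ is an idempotent algebra, $B,C\subseteq M(A)$ commuting subalgebras with $BA=A=AB$, $CA=A=AC$, $t_B:B\to C$, $t_C:C\to B$ anti-isomorphisms; put $S_C=t_B^{-1}$, $S_B=t_C^{-1}$. Balanced tensor products (quotients of $A\otimes A$; $x\in B$, $y\in C$): $A_B\otimes{}_BA$: $ax\otimes b=a\otimes xb$; $A_C\otimes{}_CA$: $ay\otimes b=a\otimes yb$; $A^B\otimes{}^BA$: $t_B(x)a\otimes b=a\otimes bt_B(x)$; $A^C\otimes{}^CA$: $t_C(y)a\otimes b=a\otimes bt_C(y)$; $A_B\otimes{}^BA$: $ax\otimes b=a\otimes bt_B(x)$; $A^C\otimes{}_CA$: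 $t_C(y)a\otimes b=a\otimes yb$. One requires: $A^C\otimes{}_CA$ is non-degenerate as a right module over $A\otimes1$ and over $1\otimes A$, and $A_B\otimes{}^BA$ as a left module over these. $\Delta_C$ is a homomorphism from $A$ to the endomorphisms $T$ of $A^C\otimes{}_CA$ for which there are $T(a\otimes1),T(1\otimes b)\in A^C\otimes{}_CA$ with $T(a\otimes b)=(T(a\otimes1))(1\otimes b)=(T(1\otimes b))(a\otimes1)$; $\Delta_B$ is a homomorphism from $A$ to the analogous endomorphisms of $A_B\otimes{}^BA$ acting from the right, with $(a\otimes1)T,(1\otimes b)T\in A_B\otimes{}^BA$. Both satisfy $\Delta(xyax'y')=(y\otimes x)\Delta(a)(y'\otimes x')$ for $x,x'\in B$, $y,y'\in C$, and coassociativity: $(\Delta_C\otimes\iota)(\Delta_C(b)(1\otimes c))(a\otimes1\otimes1)=(\iota\otimes\Delta_C)(\Delta_C(b)(a\otimes1))(1\otimes1\otimes c)$; $(a\otimes1\otimes1)(\Delta_B\otimes\iota)((1\otimes c)\Delta_B(b))=(1\otimes1\otimes c)(\iota\otimes\Delta_B)((a\otimes1)\Delta_B(b))$; $(a\otimes1\otimes1)(\Delta_B\otimes\iota)(\Delta_C(b)(1\otimes c))=(\iota\otimes\Delta_C)((a\otimes1)\Delta_B(b))(1\otimes1\otimes c)$; $(1\otimes1\otimes c)(\iota\otimes\Delta_B)(\Delta_C(b)(a\otimes1))=(\Delta_C\otimes\iota)((1\otimes c)\Delta_B(b))(a\otimes1\otimes1)$. The canonical maps $\mathfrak T_1:A_B\otimes{}_BA\to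 A^C\otimes{}_CA$, $a\otimes b\mapsto\Delta_C(a)(1\otimes b)$; $\mathfrak T_2:A_C\otimes{}_CA\to A_B\otimes{}^BA$, $a\otimes b\mapsto(a\otimes1)\Delta_B(b)$; $\mathfrak T_3:A^C\otimes{}^CA\to A_B\otimes{}^BA$, $a\otimes b\mapsto(1\otimes b)\Delta_B(a)$; $\mathfrak T_4:A^B\otimes{}^BA\to A^C\otimes{}_CA$, $a\otimes b\mapsto\Delta_C(b)(a\otimes1)$ are bijective. Finally there are (unique) counits $\varepsilon_B:A\to B$, ${}_C\varepsilon:A\to C$ and an antipode $S$, an anti-automorphism of $A$ whose extension to $M(A)$ restricts to $S_B,S_C$: the map $p\otimes q\mapsto{}_C\varepsilon(p)q$ sends $\Delta_C(a)(1\otimes b)$ to $ab$, $p\otimes q\mapsto t_C({}_C\varepsilon(q))p$ sends $\Delta_C(b)(a\otimes1)$ to $ba$, $p\otimes q\mapsto p\,\varepsilon_B(q)$ sends $(a\otimes1)\Delta_B(b)$ to $ab$, $p\otimes q\mapsto q\,t_B(\varepsilon_B(p))$ sends $(1\otimes b)\Delta_B(a)$ to $ba$, $p\otimes q\mapsto S(p)q$ sends $\Delta_C(a)(1\otimes b)$ to $\varepsilon_B(a)b$, and $p\otimes q\mapsto pS(q)$ sends $(a\otimes1)\Delta_B(b)$ to $a\,{}_C\varepsilon(b)$. MEASURED. A measured regular multiplier Hopf algebroid is a regular multiplier Hopf algebroid $\mathfrak A$ with faithful functionals $\mu_B,\mu_C$ on $B,C$ and linear maps $\Phi:A\to C$,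 $\Psi:A\to B$ such that: (1) $\mu_C=\mu_B\circ S_C$, $\mu_B=\mu_C\circ S_B$, $\mu_B\circ\varepsilon_B=\mu_C\circ{}_C\varepsilon$; (2) $\Phi(yay')=y\Phi(a)y'$ and $\Psi(xax')=x\Psi(a)x'$ for $a\in A$, $x,x'\in B$, $y,y'\in C$, and: $p\otimes q\mapsto pS_C(\Phi(q))$ sends $(a\otimes1)\Delta_B(b)$ to $a\Phi(b)$; $p\otimes q\mapsto t_C(\Phi(q))p$ sends $\Delta_C(b)(a\otimes1)$ to $\Phi(b)a$; $p\otimes q\mapsto S_B(\Psi(p))q$ sends $\Delta_C(a)(1\otimes b)$ to $\Psi(a)b$; $p\otimes q\mapsto q\,t_B(\Psi(p))$ sends $(1\otimes b)\Delta_B(a)$ to $b\Psi(a)$; (3) the integrals are $\varphi:=\mu_C\circ\Phi$ and $\psi:=\mu_B\circ\Psi$; (4) there are surjective linear maps ${}_B\Phi,\Phi_B:A\to B$ and ${}_C\Psi,\Psi_C:A\to C$ with ${}_B\Phi(xa)=x\,{}_B\Phi(a)$, $\Phi_B(ax)=\Phi_B(a)x$, ${}_C\Psi(ya)=y\,{}_C\Psi(a)$, $\Psi_C(ay)=\Psi_C(a)y$ and $\varphi=\mu_B\circ{}_B\Phi=\mu_B\circ\Phi_B$, $\psi=\mu_C\circ{}_C\Psi=\mu_C\circ\Psi_C$. Known consequences: $\varphi,\psi$ are faithful and $\mu_B(x_1x)=\mu_B(S^2(x)x_1)$ for $x,x_1\in B$. DUAL OF A MEASURED REGULAR MULTIPLIER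 HOPF ALGEBROID (Timmermann; existence known). Let $\widehat A$ be the span of the functionals $\varphi(\,\cdot\,c)$, $c\in A$; it is also the span of the $\varphi(c\,\cdot\,)$, and the same space arises from $\psi$. Each $\omega\in\widehat A$ has unique linear maps ${}_B\omega,\omega_B:A\to B$, ${}_C\omega,\omega_C:A\to C$ with ${}_B\omega(xa)=x\,{}_B\omega(a)$, $\omega_B(ax)=\omega_B(a)x$, ${}_C\omega(ya)=y\,{}_C\omega(a)$, $\omega_C(ay)=\omega_C(a)y$ and $\omega=\mu_B\circ{}_B\omega=\mu_B\circ\omega_B=\mu_C\circ{}_C\omega=\mu_C\circ\omega_C$. Put $b\triangleright\omega=\omega(\,\cdot\,b)$. The product of $\widehat A$ is determined by $(\upsilon\,(b\triangleright\omega))(a)=\sum_i\mu_C(S({}_B\upsilon(p_i))\,{}_C\omega(q_i))$ where $\Delta_C(a)(1\otimes b)=\sum_ip_i\otimes q_i$ in $A^C\otimes{}_CA$. There are injective homomorphisms $\eta_B:B\to M(\widehat A)$, $\eta_C:C\to M(\widehat A)$ given by $\omega\eta_B(x)=\omega(x\,\cdot\,)$, $\eta_B(x)\omega=\omega(S_C^{-1}(x)\,\cdot\,)$, $\omega\eta_C(y)=\omega(\,\cdot\,S_B^{-1}(y))$, $\eta_C(y)\omega=\omega(\,\cdot\,y)$. The dual $\mathfrak A'$ is the regular multiplier Hopf algebroid with total algebra $A'=\widehat A$, $B'=\eta_C(C)$, $C'=\eta_B(B)$, antipode $S'(\omega)=\omega\circ S$ (so $S'(\eta_C(y))=\eta_B(S_B^{-1}(y))$,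 $S'(\eta_B(x))=\eta_C(S_C^{-1}(x))$), $t_{B'}=S_{C'}'^{-1}$, $t_{C'}=S_{B'}'^{-1}$, and coproducts $\Delta'_{B'},\Delta'_{C'}$ determined by requiring its canonical maps $\mathfrak T_2'$, $\mathfrak T_1'$ to be the transposes of $\mathfrak T_1$, $\mathfrak T_2$ with respect to the pairings of balanced tensor products induced by $\mu_C(S({}_B\upsilon(p))\,{}_C\omega(q))$ and $\mu_B(\upsilon_B(p)\,{}_B\omega(q))$ (for $\mathfrak T_1,\mathfrak T_2'$), resp. by $\mu_B(\upsilon_B(p)S(\omega_C(q)))$ and $\mu_C(\upsilon_C(p)\,{}_C\omega(q))$ (for $\mathfrak T_2,\mathfrak T'_1$), evaluated on $p\otimes q$ and $\upsilon\otimes\omega$. ADMISSIBLE PAIRINGS. A non-degenerate bilinear form on $A\times A'$ is an admissible pairing if there are unital left and right actions ("unital": the module is spanned by the elements $a\cdot m$, resp. $m\cdot a$) with $\langle a,a'b'\rangle=\langle a\triangleleft a',b'\rangle=\langle b'\triangleright a,a'\rangle$ and $\langle ab,a'\rangle=\langle a,b\triangleright a'\rangle=\langle b,a'\triangleleft a\rangle$. PAIRING OF MULTIPLIER HOPF ALGEBROIDS. Let $\mathfrak A,\mathfrak A'$ be regular multiplier Hopf algebroids with underlying algebras $A,A'$, antipodes $S,S'$, and let $\mu_B$ be a faithful functional on $B$ with $\mu_B(x_1x)=\mu_B(S^2(x)x_1)$ for $x,x_1\in B$ (in the theorem: the $\mu_B$ of the measured structure); put $\mu_C=\mu_B\circ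 S$ on $C$. An admissible pairing $\langle\cdot,\cdot\rangle$ of $A$ and $A'$ is a pairing of multiplier Hopf algebroids if: (a) $\langle S(a),a'\rangle=\langle a,S'(a')\rangle$; (b) there are anti-isomorphisms $\alpha:B\to B'$, $\beta:C\to C'$ with $\langle ax,a'\rangle=\langle a,a'\alpha(x)\rangle$, $\langle xa,a'\rangle=\langle a,a'S'(\alpha(x))\rangle$, $\langle ya,a'\rangle=\langle a,\beta(y)a'\rangle$, $\langle ay,a'\rangle=\langle a,S'(\beta(y))a'\rangle$ (then $B',C'$ carry $\mu_{B'}=\mu_B\circ\alpha^{-1}$, $\mu_{C'}=\mu_C\circ\beta^{-1}$); (c) for all $a\in A,a'\in A'$ there are $x_1,x_2\in B$ with $\langle xa,a'\rangle=\mu_B(xx_1)$ and $\langle ax,a'\rangle=\mu_B(x_2x)$ for all $x\in B$. Then there are unique bilinear maps $\gamma_1,\gamma_2:A\times A'\to B$ and $\rho_1,\rho_2:A\times A'\to C$ with $\langle xa,a'\rangle=\mu_B(x\gamma_1(a,a'))$, $\langle ax,a'\rangle=\mu_B(\gamma_2(a,a')x)$, $\langle ya,a'\rangle=\mu_C(y\rho_1(a,a'))$, $\langle ay,a'\rangle=\mu_C(\rho_2(a,a')y)$; (d) the well-defined pairings given on representatives by $\langle a\otimes b,a'\otimes b'\rangle_1=\mu_C(S(\gamma_1(a,a'))\rho_1(b,b'))$ on $(A^C\otimes{}_CA)\times(A'_{C'}\otimes{}_{C'}A')$, $\langle a\otimes b,a'\otimes b'\rangle_2=\mu_B(\gamma_2(a,a')\gamma_1(b,b'))$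 on $(A_B\otimes{}_BA)\times(A'_{B'}\otimes{}^{B'}A')$, $\langle a\otimes b,a'\otimes b'\rangle_3=\mu_B(\gamma_2(a,a')S(\rho_2(b,b')))$ on $(A_B\otimes{}^BA)\times(A'_{B'}\otimes{}_{B'}A')$, $\langle a\otimes b,a'\otimes b'\rangle_4=\mu_C(\rho_2(a,a')\rho_1(b,b'))$ on $(A_C\otimes{}_CA)\times(A'^{C'}\otimes{}_{C'}A')$ satisfy $\langle\mathfrak T_1u,u'\rangle_1=\langle u,\mathfrak T_2'u'\rangle_2$ for $u\in A_B\otimes{}_BA$, $u'\in A'_{C'}\otimes{}_{C'}A'$, and $\langle\mathfrak T_2u,u'\rangle_3=\langle u,\mathfrak T_1'u'\rangle_4$ for $u\in A_C\otimes{}_CA$, $u'\in A'_{B'}\otimes{}_{B'}A'$. *)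

theory Defs
  imports Complex_Main "HOL-Library.Poly_Mapping" "HOL-Library.Function_Algebras"
begin

section \<open>Complex vector spaces and algebras without unit\<close>

class scaleC =
  fixes scaleC :: "complex \<Rightarrow> 'a \<Rightarrow> 'a" (infixr "*\<^sub>C" 75)

class complex_vector = scaleC + ab_group_add +
  assumes scaleC_add_right: "c *\<^sub>C (u + v) = c *\<^sub>C u + c *\<^sub>C v"
    and scaleC_add_left: "(c + d) *\<^sub>C u = c *\<^sub>C u + d *\<^sub>C u"
    and scaleC_scaleC: "c *\<^sub>C (d *\<^sub>C u) = (c * d) *\<^sub>C u"
    and scaleC_one: "1 *\<^sub>C u = u"

class complex_algebra = complex_vector + ring +
  assumes scaleC_mult_left: "(c *\<^sub>C a) * b = c *\<^sub>C (a * b)"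
    and scaleC_mult_right: "a * (c *\<^sub>C b) = c *\<^sub>C (a * b)"

interpretation cvec: vector_space "scaleC :: complex \<Rightarrow> 'a \<Rightarrow> 'a::complex_vector"
  by standard (rule scaleC_add_right scaleC_add_left scaleC_scaleC scaleC_one)+

abbreviation clinear :: "('a::complex_vector \<Rightarrow> 'b::complex_vector) \<Rightarrow> bool" where
  "clinear \<equiv> Vector_Spaces.linear scaleC scaleC"

lemma clinearI:
  assumes "\<And>u v. f (u + v) = f u + f v" and "\<And>c u. f (c *\<^sub>C u) = c *\<^sub>C f u"
  shows "clinear f"
  unfolding Vector_Spaces.linear_def module_hom_def module_hom_axioms_def
  by (auto intro: assms cvec.vector_space_axioms cvec.module_axioms)

lemma clinearD:
  assumes "clinear f"
  shows "f (u + v) = f u + f v" and "f (c *\<^sub>C u) = c *\<^sub>C f u"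
  using assms unfolding Vector_Spaces.linear_def module_hom_def module_hom_axioms_def by auto

definition cbilinear ::
  "('a::complex_vector \<Rightarrow> 'b::complex_vector \<Rightarrow> 'c::complex_vector) \<Rightarrow> bool" where
  "cbilinear f \<longleftrightarrow> (\<forall>a. clinear (f a)) \<and> (\<forall>b. clinear (\<lambda>a. f a b))"

definition linear_on :: "'a::complex_vector set \<Rightarrow> ('a \<Rightarrow> 'b::complex_vector) \<Rightarrow> bool" where
  "linear_on D f \<longleftrightarrow>
     (\<forall>u\<in>D. \<forall>v\<in>D. f (u + v) = f u + f v) \<and> (\<forall>c. \<forall>u\<in>D. f (c *\<^sub>C u) = c *\<^sub>C f u)"

instantiation complex :: complex_algebra
begin
definition scaleC_complex :: "complex \<Rightarrow> complex \<Rightarrow> complex" where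
  "scaleC_complex c z = c * z"
instance by standard (simp_all add: scaleC_complex_def algebra_simps)
end

instantiation "fun" :: (type, complex_vector) complex_vector
begin
definition scaleC_fun :: "complex \<Rightarrow> ('a \<Rightarrow> 'b) \<Rightarrow> 'a \<Rightarrow> 'b" where
  "scaleC_fun c f = (\<lambda>x. c *\<^sub>C f x)"
instance
  by standard (simp_all add: scaleC_fun_def fun_eq_iff scaleC_add_right scaleC_add_left
      scaleC_scaleC scaleC_one)
end

instantiation poly_mapping :: (type, complex_vector) complex_vector
begin
lift_definition scaleC_poly_mapping :: "complex \<Rightarrow> ('a \<Rightarrow>\<^sub>0 'b) \<Rightarrow> 'a \<Rightarrow>\<^sub>0 'b"
  is "\<lambda>c f k. c *\<^sub>C f k"
proof -
  fix c :: complex and f :: "'a \<Rightarrow> 'b"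
  assume "finite {k. f k \<noteq> 0}"
  moreover have "{k. c *\<^sub>C f k \<noteq> 0} \<subseteq> {k. f k \<noteq> 0}" by auto
  ultimately show "finite {k. c *\<^sub>C f k \<noteq> 0}" by (rule rev_finite_subset)
qed
instance
  by standard (transfer; simp add: scaleC_add_right scaleC_add_left scaleC_scaleC scaleC_one)+
end

definition nondegenerate_on :: "'a::{times,zero} set \<Rightarrow> bool" where
  "nondegenerate_on D \<longleftrightarrow>
     (\<forall>d'\<in>D. (\<forall>d\<in>D. d * d' = 0) \<longrightarrow> d' = 0) \<and> (\<forall>d'\<in>D. (\<forall>d\<in>D. d' * d = 0) \<longrightarrow> d' = 0)"

definition idempotent_algebra :: "'a::complex_algebra itself \<Rightarrow> bool" where
  "idempotent_algebra _ \<longleftrightarrow> cvec.span {a * b | a b :: 'a. True} = UNIV"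

definition faithful_functional ::
  "'a::{complex_vector, times} set \<Rightarrow> ('a \<Rightarrow> complex) \<Rightarrow> bool" where
  "faithful_functional D \<omega> \<longleftrightarrow> linear_on D \<omega> \<and>
     (\<forall>d'\<in>D. (\<forall>d\<in>D. \<omega> (d * d') = 0) \<longrightarrow> d' = 0) \<and>
     (\<forall>d'\<in>D. (\<forall>d\<in>D. \<omega> (d' * d) = 0) \<longrightarrow> d' = 0)"


section \<open>The multiplier algebra\<close>

text \<open>
  A multiplier \<open>m\<close> is a pair of maps \<open>a \<mapsto> m a\<close> and \<open>a \<mapsto> a m\<close>, written below as
  \<open>m \<rhd> a\<close> and \<open>a \<lhd> m\<close>.
\<close>

typedef (overloaded) 'a multiplier =
  "{m :: ('a::complex_algebra \<Rightarrow> 'a) \<times> ('a \<Rightarrow> 'a). case m of (L, R) \<Rightarrow>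
      clinear L \<and> clinear R \<and> (\<forall>a b. L (a * b) = L a * b) \<and>
      (\<forall>a b. R (a * b) = a * R b) \<and> (\<forall>a b. a * L b = R a * b)}"
  by (rule exI[of _ "(id, id)"]) (auto intro!: clinearI)

setup_lifting type_definition_multiplier

lift_definition mult_left :: "'a::complex_algebra multiplier \<Rightarrow> 'a \<Rightarrow> 'a" (infixr "\<rhd>" 76)
  is fst .
lift_definition mult_right :: "'a \<Rightarrow> 'a::complex_algebra multiplier \<Rightarrow> 'a" (infixl "\<lhd>" 75)
  is "\<lambda>a m. snd m a" .

instantiation multiplier :: (complex_algebra) complex_algebra
begin

lift_definition zero_multiplier :: "'a multiplier" is "(\<lambda>_. 0, \<lambda>_. 0)"
  by (auto intro!: clinearI)
lift_definition plus_multiplier :: "'a multiplier \<Rightarrow> 'a multiplier \<Rightarrow> 'a multiplier"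
  is "\<lambda>(L, R) (L', R'). (\<lambda>a. L a + L' a, \<lambda>a. R a + R' a)"
  by (auto intro!: clinearI simp: clinearD scaleC_add_right algebra_simps)
lift_definition minus_multiplier :: "'a multiplier \<Rightarrow> 'a multiplier \<Rightarrow> 'a multiplier"
  is "\<lambda>(L, R) (L', R'). (\<lambda>a. L a - L' a, \<lambda>a. R a - R' a)"
  by (auto intro!: clinearI simp: clinearD cvec.scale_right_diff_distrib algebra_simps)
lift_definition uminus_multiplier :: "'a multiplier \<Rightarrow> 'a multiplier"
  is "\<lambda>(L, R). (\<lambda>a. - L a, \<lambda>a. - R a)"
  by (auto intro!: clinearI simp: clinearD algebra_simps)
lift_definition times_multiplier :: "'a multiplier \<Rightarrow> 'a multiplier \<Rightarrow> 'a multiplier"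
  is "\<lambda>(L, R) (L', R'). (\<lambda>a. L (L' a), \<lambda>a. R' (R a))"
  by (auto intro!: clinearI simp: clinearD)
lift_definition scaleC_multiplier :: "complex \<Rightarrow> 'a multiplier \<Rightarrow> 'a multiplier"
  is "\<lambda>c (L, R). (\<lambda>a. c *\<^sub>C L a, \<lambda>a. c *\<^sub>C R a)"
  by (auto intro!: clinearI simp: clinearD scaleC_add_right scaleC_scaleC scaleC_mult_left
      scaleC_mult_right mult.commute)

instance
  by standard (transfer; auto simp: fun_eq_iff scaleC_add_right scaleC_add_left scaleC_scaleC
      scaleC_one clinearD algebra_simps)+
end

definition subalgebra :: "'a::complex_algebra set \<Rightarrow> bool" where
  "subalgebra D \<longleftrightarrow> cvec.subspace D \<and> (\<forall>x\<in>D. \<forall>x'\<in>D. x * x' \<in> D)"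

definition anti_isomorphism :: "'a::complex_algebra set \<Rightarrow> 'b::complex_algebra set \<Rightarrow> ('a \<Rightarrow> 'b) \<Rightarrow> bool"
  where "anti_isomorphism D E f \<longleftrightarrow>
     bij_betw f D E \<and> linear_on D f \<and> (\<forall>x\<in>D. \<forall>x'\<in>D. f (x * x') = f x' * f x)"

definition injective_homomorphism ::
  "'a::complex_algebra set \<Rightarrow> ('a \<Rightarrow> 'b::complex_algebra) \<Rightarrow> bool"
  where "injective_homomorphism D f \<longleftrightarrow>
     inj_on f D \<and> linear_on D f \<and> (\<forall>x\<in>D. \<forall>x'\<in>D. f (x * x') = f x * f x')"

text \<open>The extension of an anti-automorphism \<open>S\<close> of a non-degenerate algebra to its multipliers.\<close>

definition anti_extension ::
  "('a::complex_algebra \<Rightarrow> 'a) \<Rightarrow> 'a multiplier \<Rightarrow> 'a multiplier" where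
  "anti_extension S m = (THE n. \<forall>a. S (m \<rhd> a) = S a \<lhd> n \<and> S (a \<lhd> m) = n \<rhd> S a)"


section \<open>Balanced tensor products\<close>

text \<open>
  \<open>'a ten\<close> is the free vector space on \<open>A \<times> A\<close>. A balanced tensor product is its quotient by a
  subspace \<open>K\<close>; elements of the quotient are handled through representatives \<open>u :: 'a ten\<close>, and
  equality of classes is written \<open>u - v \<in> K\<close>.
\<close>

type_synonym 'a ten = "('a \<times> 'a) \<Rightarrow>\<^sub>0 complex"
type_synonym 'a ten3 = "('a \<times> 'a \<times> 'a) \<Rightarrow>\<^sub>0 complex"

abbreviation pure :: "'a \<Rightarrow> 'a \<Rightarrow> 'a ten" where
  "pure a b \<equiv> Poly_Mapping.single (a, b) 1"
abbreviation pure3 :: "'a \<Rightarrow> 'a \<Rightarrow> 'a \<Rightarrow> 'a ten3" where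
  "pure3 a b c \<equiv> Poly_Mapping.single (a, b, c) 1"

definition lin_ext :: "('k \<Rightarrow> 'v::complex_vector) \<Rightarrow> ('k \<Rightarrow>\<^sub>0 complex) \<Rightarrow> 'v" where
  "lin_ext f u = (\<Sum>k\<in>Poly_Mapping.keys u. Poly_Mapping.lookup u k *\<^sub>C f k)"

definition tensor_map :: "('a \<Rightarrow> 'a) \<Rightarrow> ('a \<Rightarrow> 'a) \<Rightarrow> 'a ten \<Rightarrow> 'a ten" where
  "tensor_map f g = lin_ext (\<lambda>(p, q). pure (f p) (g q))"

definition bilinear_relators :: "'a::complex_vector ten set" where
  "bilinear_relators =
     {pure (a + a') b - pure a b - pure a' b | a a' b. True} \<union>
     {pure a (b + b') - pure a b - pure a b' | a b b'. True} \<union>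
     {pure (c *\<^sub>C a) b - c *\<^sub>C pure a b | c a b. True} \<union>
     {pure a (c *\<^sub>C b) - c *\<^sub>C pure a b | c a b. True}"

definition trilinear_relators :: "'a::complex_vector ten3 set" where
  "trilinear_relators =
     {pure3 (a + a') b c - pure3 a b c - pure3 a' b c | a a' b c. True} \<union>
     {pure3 a (b + b') c - pure3 a b c - pure3 a b' c | a b b' c. True} \<union>
     {pure3 a b (c + c') - pure3 a b c - pure3 a b c' | a b c c'. True} \<union>
     {pure3 (z *\<^sub>C a) b c - z *\<^sub>C pure3 a b c | z a b c. True} \<union>
     {pure3 a (z *\<^sub>C b) c - z *\<^sub>C pure3 a b c | z a b c. True} \<union>
     {pure3 a b (z *\<^sub>C c) - z *\<^sub>C pure3 a b c | z a b c. True}"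

text \<open>
  A balancing relation \<open>r\<close> contains the pairs \<open>((a, b), (a', b'))\<close> for which \<open>a \<otimes> b = a' \<otimes> b'\<close> is
  imposed; \<open>tensor3_kernel r s\<close> imposes \<open>r\<close> on the first two legs and \<open>s\<close> on the last two.
\<close>

definition tensor_kernel ::
  "(('a::complex_vector \<times> 'a) \<times> ('a \<times> 'a)) set \<Rightarrow> 'a ten set" where
  "tensor_kernel r = cvec.span (bilinear_relators \<union>
     {pure a b - pure a' b' | a b a' b'. ((a, b), (a', b')) \<in> r})"

definition tensor3_kernel ::
  "(('a::complex_vector \<times> 'a) \<times> ('a \<times> 'a)) set \<Rightarrow> (('a \<times> 'a) \<times> ('a \<times> 'a)) set \<Rightarrow> 'a ten3 set"
  where "tensor3_kernel r s = cvec.span (trilinear_relators \<union>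
     {pure3 a b c - pure3 a' b' c | a b a' b' c. ((a, b), (a', b')) \<in> r} \<union>
     {pure3 c a b - pure3 c a' b' | a b a' b' c. ((a, b), (a', b')) \<in> s})"

definition expand_left :: "('a \<Rightarrow> 'a ten) \<Rightarrow> 'a ten \<Rightarrow> 'a ten3" where
  "expand_left F = lin_ext (\<lambda>(p, q). lin_ext (\<lambda>(r, s). pure3 r s q) (F p))"

definition expand_right :: "('a \<Rightarrow> 'a ten) \<Rightarrow> 'a ten \<Rightarrow> 'a ten3" where
  "expand_right F = lin_ext (\<lambda>(p, q). lin_ext (\<lambda>(r, s). pure3 p r s) (F q))"

text \<open>
  \<open>sends K f w v\<close>: the linear map induced by \<open>p \<otimes> q \<mapsto> f (p, q)\<close> on the quotient by \<open>K\<close> takes the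
  class of \<open>w\<close> to \<open>v\<close>; quantifying over all representatives makes its well-definedness part of
  the assertion.
\<close>

definition sends ::
  "'a::complex_vector ten set \<Rightarrow> ('a \<times> 'a \<Rightarrow> 'v::complex_vector) \<Rightarrow> 'a ten \<Rightarrow> 'v \<Rightarrow> bool" where
  "sends K f w v \<longleftrightarrow> (\<forall>u. u - w \<in> K \<longrightarrow> lin_ext f u = v)"

definition bijective_mod ::
  "'a::complex_vector ten set \<Rightarrow> 'a ten set \<Rightarrow> ('a ten \<Rightarrow> 'a ten) \<Rightarrow> bool" where
  "bijective_mod K K' T \<longleftrightarrow> (\<forall>u. T u \<in> K' \<longleftrightarrow> u \<in> K) \<and> (\<forall>v. \<exists>u. T u - v \<in> K')"

definition endomorphism_mod :: "'a::complex_vector ten set \<Rightarrow> ('a ten \<Rightarrow> 'a ten) \<Rightarrow> bool" where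
  "endomorphism_mod K T \<longleftrightarrow> clinear T \<and> (\<forall>u\<in>K. T u \<in> K)"


section \<open>Regular multiplier Hopf algebroids\<close>

text \<open>
  The total algebra is the type \<open>'a\<close>. The endomorphism \<open>Delta_B a\<close> acts from the right, i.e.
  \<open>Delta_B H a u\<close> represents \<open>u \<Delta>\<^sub>B(a)\<close>, whereas \<open>Delta_C H a u\<close> represents \<open>\<Delta>\<^sub>C(a) u\<close>.
  The counits and the antipode are uniquely determined by the other components.
\<close>

record (overloaded) 'a::complex_algebra hopf_algebroid =
  base_B :: "'a multiplier set"
  base_C :: "'a multiplier set"
  t_B :: "'a multiplier \<Rightarrow> 'a multiplier"
  t_C :: "'a multiplier \<Rightarrow> 'a multiplier"
  Delta_B :: "'a \<Rightarrow> 'a ten \<Rightarrow> 'a ten"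
  Delta_C :: "'a \<Rightarrow> 'a ten \<Rightarrow> 'a ten"
  eps_B :: "'a \<Rightarrow> 'a multiplier"
  eps_C :: "'a \<Rightarrow> 'a multiplier"
  antipode :: "'a \<Rightarrow> 'a"

definition S_B :: "('a::complex_algebra, 'm) hopf_algebroid_scheme \<Rightarrow> 'a multiplier \<Rightarrow> 'a multiplier"
  where "S_B H = inv_into (base_C H) (t_C H)"

definition S_C :: "('a::complex_algebra, 'm) hopf_algebroid_scheme \<Rightarrow> 'a multiplier \<Rightarrow> 'a multiplier"
  where "S_C H = inv_into (base_B H) (t_B H)"

definition S_ext :: "('a::complex_algebra, 'm) hopf_algebroid_scheme \<Rightarrow> 'a multiplier \<Rightarrow> 'a multiplier"
  where "S_ext H = anti_extension (antipode H)"

text \<open>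
  The relations and kernels below belong, in this order, to
  \<open>A\<^sup>C \<otimes> \<^sub>CA\<close> (target of \<open>\<Delta>\<^sub>C\<close>), \<open>A\<^sub>B \<otimes> \<^sup>BA\<close> (target of \<open>\<Delta>\<^sub>B\<close>),
  \<open>A\<^sub>B \<otimes> \<^sub>BA\<close>, \<open>A\<^sub>C \<otimes> \<^sub>CA\<close>, \<open>A\<^sup>B \<otimes> \<^sup>BA\<close> and \<open>A\<^sup>C \<otimes> \<^sup>CA\<close>.
\<close>

definition rel_C :: "('a::complex_algebra, 'm) hopf_algebroid_scheme \<Rightarrow> (('a \<times> 'a) \<times> ('a \<times> 'a)) set"
  where "rel_C H = {((t_C H y \<rhd> a, b), (a, y \<rhd> b)) | a b y. y \<in> base_C H}"
definition rel_B :: "('a::complex_algebra, 'm) hopf_algebroid_scheme \<Rightarrow> (('a \<times> 'a) \<times> ('a \<times> 'a)) set"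
  where "rel_B H = {((a \<lhd> x, b), (a, b \<lhd> t_B H x)) | a b x. x \<in> base_B H}"

definition ker_upC_lowC :: "('a::complex_algebra, 'm) hopf_algebroid_scheme \<Rightarrow> 'a ten set"
  where "ker_upC_lowC H = tensor_kernel (rel_C H)"
definition ker_lowB_upB :: "('a::complex_algebra, 'm) hopf_algebroid_scheme \<Rightarrow> 'a ten set"
  where "ker_lowB_upB H = tensor_kernel (rel_B H)"
definition ker_lowB_lowB :: "('a::complex_algebra, 'm) hopf_algebroid_scheme \<Rightarrow> 'a ten set"
  where "ker_lowB_lowB H = tensor_kernel {((a \<lhd> x, b), (a, x \<rhd> b)) | a b x. x \<in> base_B H}"
definition ker_lowC_lowC :: "('a::complex_algebra, 'm) hopf_algebroid_scheme \<Rightarrow> 'a ten set"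
  where "ker_lowC_lowC H = tensor_kernel {((a \<lhd> y, b), (a, y \<rhd> b)) | a b y. y \<in> base_C H}"
definition ker_upB_upB :: "('a::complex_algebra, 'm) hopf_algebroid_scheme \<Rightarrow> 'a ten set"
  where "ker_upB_upB H =
    tensor_kernel {((t_B H x \<rhd> a, b), (a, b \<lhd> t_B H x)) | a b x. x \<in> base_B H}"
definition ker_upC_upC :: "('a::complex_algebra, 'm) hopf_algebroid_scheme \<Rightarrow> 'a ten set"
  where "ker_upC_upC H =
    tensor_kernel {((t_C H y \<rhd> a, b), (a, b \<lhd> t_C H y)) | a b y. y \<in> base_C H}"

text \<open>
  \<open>\<Delta>\<^sub>C(a)(c \<otimes> 1)\<close>, \<open>\<Delta>\<^sub>C(a)(1 \<otimes> d)\<close>, \<open>(c \<otimes> 1)\<Delta>\<^sub>B(a)\<close> and \<open>(1 \<otimes> d)\<Delta>\<^sub>B(a)\<close>: the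
  predicates characterise representatives, which are unique modulo the kernel by non-degeneracy.
\<close>

definition is_Delta_C_1 where
  "is_Delta_C_1 H a c w \<longleftrightarrow>
     (\<forall>d. Delta_C H a (pure c d) - tensor_map id (\<lambda>q. q * d) w \<in> ker_upC_lowC H)"
definition is_Delta_C_2 where
  "is_Delta_C_2 H a d w \<longleftrightarrow>
     (\<forall>c. Delta_C H a (pure c d) - tensor_map (\<lambda>p. p * c) id w \<in> ker_upC_lowC H)"
definition is_Delta_B_1 where
  "is_Delta_B_1 H c a w \<longleftrightarrow>
     (\<forall>d. Delta_B H a (pure c d) - tensor_map id (\<lambda>q. d * q) w \<in> ker_lowB_upB H)"
definition is_Delta_B_2 where
  "is_Delta_B_2 H d a w \<longleftrightarrow>
     (\<forall>c. Delta_B H a (pure c d) - tensor_map (\<lambda>p. c * p) id w \<in> ker_lowB_upB H)"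

definition Delta_C_1 :: "('a::complex_algebra, 'm) hopf_algebroid_scheme \<Rightarrow> 'a \<Rightarrow> 'a \<Rightarrow> 'a ten"
  where "Delta_C_1 H a c = (SOME w. is_Delta_C_1 H a c w)"
definition Delta_C_2 :: "('a::complex_algebra, 'm) hopf_algebroid_scheme \<Rightarrow> 'a \<Rightarrow> 'a \<Rightarrow> 'a ten"
  where "Delta_C_2 H a d = (SOME w. is_Delta_C_2 H a d w)"
definition Delta_B_1 :: "('a::complex_algebra, 'm) hopf_algebroid_scheme \<Rightarrow> 'a \<Rightarrow> 'a \<Rightarrow> 'a ten"
  where "Delta_B_1 H c a = (SOME w. is_Delta_B_1 H c a w)"
definition Delta_B_2 :: "('a::complex_algebra, 'm) hopf_algebroid_scheme \<Rightarrow> 'a \<Rightarrow> 'a \<Rightarrow> 'a ten"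
  where "Delta_B_2 H d a = (SOME w. is_Delta_B_2 H d a w)"

definition canonical_T1 :: "('a::complex_algebra, 'm) hopf_algebroid_scheme \<Rightarrow> 'a ten \<Rightarrow> 'a ten"
  where "canonical_T1 H = lin_ext (\<lambda>(a, b). Delta_C_2 H a b)"
definition canonical_T2 :: "('a::complex_algebra, 'm) hopf_algebroid_scheme \<Rightarrow> 'a ten \<Rightarrow> 'a ten"
  where "canonical_T2 H = lin_ext (\<lambda>(a, b). Delta_B_1 H a b)"
definition canonical_T3 :: "('a::complex_algebra, 'm) hopf_algebroid_scheme \<Rightarrow> 'a ten \<Rightarrow> 'a ten"
  where "canonical_T3 H = lin_ext (\<lambda>(a, b). Delta_B_2 H b a)"
definition canonical_T4 :: "('a::complex_algebra, 'm) hopf_algebroid_scheme \<Rightarrow> 'a ten \<Rightarrow> 'a ten"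
  where "canonical_T4 H = lin_ext (\<lambda>(a, b). Delta_C_1 H b a)"

definition base_algebras :: "('a::complex_algebra, 'm) hopf_algebroid_scheme \<Rightarrow> bool" where
  "base_algebras H \<longleftrightarrow>
     nondegenerate_on (UNIV :: 'a set) \<and> idempotent_algebra TYPE('a) \<and>
     subalgebra (base_B H) \<and> nondegenerate_on (base_B H) \<and>
     subalgebra (base_C H) \<and> nondegenerate_on (base_C H) \<and>
     (\<forall>x\<in>base_B H. \<forall>y\<in>base_C H. x * y = y * x) \<and>
     cvec.span {x \<rhd> a | x a. x \<in> base_B H} = UNIV \<and>
     cvec.span {a \<lhd> x | x a. x \<in> base_B H} = UNIV \<and>
     cvec.span {y \<rhd> a | y a. y \<in> base_C H} = UNIV \<and>
     cvec.span {a \<lhd> y | y a. y \<in> base_C H} = UNIV \<and>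
     anti_isomorphism (base_B H) (base_C H) (t_B H) \<and>
     anti_isomorphism (base_C H) (base_B H) (t_C H)"

definition nondegenerate_tensors :: "('a::complex_algebra, 'm) hopf_algebroid_scheme \<Rightarrow> bool" where
  "nondegenerate_tensors H \<longleftrightarrow>
     (\<forall>u. (\<forall>a. tensor_map (\<lambda>p. p * a) id u \<in> ker_upC_lowC H) \<longrightarrow> u \<in> ker_upC_lowC H) \<and>
     (\<forall>u. (\<forall>a. tensor_map id (\<lambda>q. q * a) u \<in> ker_upC_lowC H) \<longrightarrow> u \<in> ker_upC_lowC H) \<and>
     (\<forall>u. (\<forall>a. tensor_map (\<lambda>p. a * p) id u \<in> ker_lowB_upB H) \<longrightarrow> u \<in> ker_lowB_upB H) \<and>
     (\<forall>u. (\<forall>a. tensor_map id (\<lambda>q. a * q) u \<in> ker_lowB_upB H) \<longrightarrow> u \<in> ker_lowB_upB H)"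

definition comultiplication_C :: "('a::complex_algebra, 'm) hopf_algebroid_scheme \<Rightarrow> bool" where
  "comultiplication_C H \<longleftrightarrow>
     (\<forall>a. endomorphism_mod (ker_upC_lowC H) (Delta_C H a)) \<and>
     (\<forall>a b u. Delta_C H (a + b) u - (Delta_C H a u + Delta_C H b u) \<in> ker_upC_lowC H) \<and>
     (\<forall>c a u. Delta_C H (c *\<^sub>C a) u - c *\<^sub>C Delta_C H a u \<in> ker_upC_lowC H) \<and>
     (\<forall>a b u. Delta_C H (a * b) u - Delta_C H a (Delta_C H b u) \<in> ker_upC_lowC H) \<and>
     (\<forall>a c. \<exists>w. is_Delta_C_1 H a c w) \<and> (\<forall>a d. \<exists>w. is_Delta_C_2 H a d w) \<and>
     (\<forall>x\<in>base_B H. \<forall>y\<in>base_C H. \<forall>x'\<in>base_B H. \<forall>y'\<in>base_C H. \<forall>a u.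
        Delta_C H ((x \<rhd> y \<rhd> a) \<lhd> x' \<lhd> y') u
        - tensor_map (\<lambda>p. y \<rhd> p) (\<lambda>q. x \<rhd> q)
            (Delta_C H a (tensor_map (\<lambda>p. y' \<rhd> p) (\<lambda>q. x' \<rhd> q) u)) \<in> ker_upC_lowC H)"

definition comultiplication_B :: "('a::complex_algebra, 'm) hopf_algebroid_scheme \<Rightarrow> bool" where
  "comultiplication_B H \<longleftrightarrow>
     (\<forall>a. endomorphism_mod (ker_lowB_upB H) (Delta_B H a)) \<and>
     (\<forall>a b u. Delta_B H (a + b) u - (Delta_B H a u + Delta_B H b u) \<in> ker_lowB_upB H) \<and>
     (\<forall>c a u. Delta_B H (c *\<^sub>C a) u - c *\<^sub>C Delta_B H a u \<in> ker_lowB_upB H) \<and>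
     (\<forall>a b u. Delta_B H (a * b) u - Delta_B H b (Delta_B H a u) \<in> ker_lowB_upB H) \<and>
     (\<forall>c a. \<exists>w. is_Delta_B_1 H c a w) \<and> (\<forall>d a. \<exists>w. is_Delta_B_2 H d a w) \<and>
     (\<forall>x\<in>base_B H. \<forall>y\<in>base_C H. \<forall>x'\<in>base_B H. \<forall>y'\<in>base_C H. \<forall>a u.
        Delta_B H ((x \<rhd> y \<rhd> a) \<lhd> x' \<lhd> y') u
        - tensor_map (\<lambda>p. p \<lhd> y') (\<lambda>q. q \<lhd> x')
            (Delta_B H a (tensor_map (\<lambda>p. p \<lhd> y) (\<lambda>q. q \<lhd> x) u)) \<in> ker_lowB_upB H)"

definition coassociative :: "('a::complex_algebra, 'm) hopf_algebroid_scheme \<Rightarrow> bool" where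
  "coassociative H \<longleftrightarrow> (\<forall>a b c.
     expand_left (\<lambda>p. Delta_C_1 H p a) (Delta_C_2 H b c)
       - expand_right (\<lambda>q. Delta_C_2 H q c) (Delta_C_1 H b a)
       \<in> tensor3_kernel (rel_C H) (rel_C H) \<and>
     expand_left (\<lambda>p. Delta_B_1 H a p) (Delta_B_2 H c b)
       - expand_right (\<lambda>q. Delta_B_2 H c q) (Delta_B_1 H a b)
       \<in> tensor3_kernel (rel_B H) (rel_B H) \<and>
     expand_left (\<lambda>p. Delta_B_1 H a p) (Delta_C_2 H b c)
       - expand_right (\<lambda>q. Delta_C_2 H q c) (Delta_B_1 H a b)
       \<in> tensor3_kernel (rel_B H) (rel_C H) \<and>
     expand_right (\<lambda>q. Delta_B_2 H c q) (Delta_C_1 H b a)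
       - expand_left (\<lambda>p. Delta_C_1 H p a) (Delta_B_2 H c b)
       \<in> tensor3_kernel (rel_C H) (rel_B H))"

definition canonical_maps_bijective :: "('a::complex_algebra, 'm) hopf_algebroid_scheme \<Rightarrow> bool" where
  "canonical_maps_bijective H \<longleftrightarrow>
     bijective_mod (ker_lowB_lowB H) (ker_upC_lowC H) (canonical_T1 H) \<and>
     bijective_mod (ker_lowC_lowC H) (ker_lowB_upB H) (canonical_T2 H) \<and>
     bijective_mod (ker_upC_upC H) (ker_lowB_upB H) (canonical_T3 H) \<and>
     bijective_mod (ker_upB_upB H) (ker_upC_lowC H) (canonical_T4 H)"

definition counits_and_antipode :: "('a::complex_algebra, 'm) hopf_algebroid_scheme \<Rightarrow> bool" where
  "counits_and_antipode H \<longleftrightarrow>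
     clinear (eps_B H) \<and> range (eps_B H) \<subseteq> base_B H \<and>
     clinear (eps_C H) \<and> range (eps_C H) \<subseteq> base_C H \<and>
     anti_isomorphism UNIV UNIV (antipode H) \<and>
     (\<forall>x\<in>base_B H. S_ext H x = S_B H x) \<and> (\<forall>y\<in>base_C H. S_ext H y = S_C H y) \<and>
     (\<forall>a b.
        sends (ker_upC_lowC H) (\<lambda>(p, q). eps_C H p \<rhd> q) (Delta_C_2 H a b) (a * b) \<and>
        sends (ker_upC_lowC H) (\<lambda>(p, q). t_C H (eps_C H q) \<rhd> p) (Delta_C_1 H b a) (b * a) \<and>
        sends (ker_lowB_upB H) (\<lambda>(p, q). p \<lhd> eps_B H q) (Delta_B_1 H a b) (a * b) \<and>
        sends (ker_lowB_upB H) (\<lambda>(p, q). q \<lhd> t_B H (eps_B H p)) (Delta_B_2 H b a) (b * a) \<and>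
        sends (ker_upC_lowC H) (\<lambda>(p, q). antipode H p * q) (Delta_C_2 H a b) (eps_B H a \<rhd> b) \<and>
        sends (ker_lowB_upB H) (\<lambda>(p, q). p * antipode H q) (Delta_B_1 H a b) (a \<lhd> eps_C H b))"

definition regular_multiplier_hopf_algebroid ::
  "('a::complex_algebra, 'm) hopf_algebroid_scheme \<Rightarrow> bool" where
  "regular_multiplier_hopf_algebroid H \<longleftrightarrow>
     base_algebras H \<and> nondegenerate_tensors H \<and> comultiplication_C H \<and> comultiplication_B H \<and>
     coassociative H \<and> canonical_maps_bijective H \<and> counits_and_antipode H"


section \<open>Measured regular multiplier Hopf algebroids\<close>

record (overloaded) 'a::complex_algebra measured_hopf_algebroid = "'a hopf_algebroid" +
  mu_B :: "'a multiplier \<Rightarrow> complex"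
  mu_C :: "'a multiplier \<Rightarrow> complex"
  Phi :: "'a \<Rightarrow> 'a multiplier"
  Psi :: "'a \<Rightarrow> 'a multiplier"

definition phi :: "('a::complex_algebra, 'm) measured_hopf_algebroid_scheme \<Rightarrow> 'a \<Rightarrow> complex"
  where "phi M a = mu_C M (Phi M a)"
definition psi :: "('a::complex_algebra, 'm) measured_hopf_algebroid_scheme \<Rightarrow> 'a \<Rightarrow> complex"
  where "psi M a = mu_B M (Psi M a)"

text \<open>
  \<open>is_left_factor D \<mu> \<omega> f\<close>: \<open>f\<close> is a left \<open>D\<close>-linear map \<open>A \<rightarrow> D\<close> with \<open>\<omega> = \<mu> \<circ> f\<close>; likewise on
  the right.
\<close>

definition is_left_factor where
  "is_left_factor D \<mu> \<omega> f \<longleftrightarrow> clinear f \<and> range f \<subseteq> D \<and>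
     (\<forall>x\<in>D. \<forall>a. f (x \<rhd> a) = x * f a) \<and> (\<forall>a. \<omega> a = \<mu> (f a))"
definition is_right_factor where
  "is_right_factor D \<mu> \<omega> f \<longleftrightarrow> clinear f \<and> range f \<subseteq> D \<and>
     (\<forall>x\<in>D. \<forall>a. f (a \<lhd> x) = f a * x) \<and> (\<forall>a. \<omega> a = \<mu> (f a))"

text \<open>
  The last two clauses, faithfulness of the integrals, are a known consequence of the theory
  (Timmermann) rather than a separate axiom there; they are kept here as part of the structure.
\<close>

definition measured_regular_multiplier_hopf_algebroid ::
  "('a::complex_algebra, 'm) measured_hopf_algebroid_scheme \<Rightarrow> bool" where
  "measured_regular_multiplier_hopf_algebroid M \<longleftrightarrow>
     regular_multiplier_hopf_algebroid M \<and>
     faithful_functional (base_B M) (mu_B M) \<and> faithful_functional (base_C M) (mu_C M) \<and>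
     (\<forall>y\<in>base_C M. mu_C M y = mu_B M (S_C M y)) \<and>
     (\<forall>x\<in>base_B M. mu_B M x = mu_C M (S_B M x)) \<and>
     (\<forall>a. mu_B M (eps_B M a) = mu_C M (eps_C M a)) \<and>
     clinear (Phi M) \<and> range (Phi M) \<subseteq> base_C M \<and>
     clinear (Psi M) \<and> range (Psi M) \<subseteq> base_B M \<and>
     (\<forall>y\<in>base_C M. \<forall>y'\<in>base_C M. \<forall>a. Phi M (y \<rhd> a \<lhd> y') = y * Phi M a * y') \<and>
     (\<forall>x\<in>base_B M. \<forall>x'\<in>base_B M. \<forall>a. Psi M (x \<rhd> a \<lhd> x') = x * Psi M a * x') \<and>
     (\<forall>a b.
        sends (ker_lowB_upB M) (\<lambda>(p, q). p \<lhd> S_C M (Phi M q)) (Delta_B_1 M a b) (a \<lhd> Phi M b) \<and>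
        sends (ker_upC_lowC M) (\<lambda>(p, q). t_C M (Phi M q) \<rhd> p) (Delta_C_1 M b a) (Phi M b \<rhd> a) \<and>
        sends (ker_upC_lowC M) (\<lambda>(p, q). S_B M (Psi M p) \<rhd> q) (Delta_C_2 M a b) (Psi M a \<rhd> b) \<and>
        sends (ker_lowB_upB M) (\<lambda>(p, q). q \<lhd> t_B M (Psi M p)) (Delta_B_2 M b a) (b \<lhd> Psi M a)) \<and>
     (\<exists>f. is_left_factor (base_B M) (mu_B M) (phi M) f \<and> range f = base_B M) \<and>
     (\<exists>f. is_right_factor (base_B M) (mu_B M) (phi M) f \<and> range f = base_B M) \<and>
     (\<exists>f. is_left_factor (base_C M) (mu_C M) (psi M) f \<and> range f = base_C M) \<and>
     (\<exists>f. is_right_factor (base_C M) (mu_C M) (psi M) f \<and> range f = base_C M) \<and>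
     faithful_functional UNIV (phi M) \<and> faithful_functional UNIV (psi M)"


section \<open>The dual\<close>

definition dual_space :: "('a::complex_algebra, 'm) measured_hopf_algebroid_scheme \<Rightarrow> ('a \<Rightarrow> complex) set"
  where "dual_space M = cvec.span {(\<lambda>a. phi M (a * c)) | c. True}"

text \<open>The maps \<open>\<^sub>B\<omega>\<close>, \<open>\<omega>\<^sub>B\<close>, \<open>\<^sub>C\<omega>\<close>, \<open>\<omega>\<^sub>C\<close>, which exist and are unique for \<open>\<omega>\<close> in the dual space.\<close>

definition fac_lB where "fac_lB M \<omega> = (THE f. is_left_factor (base_B M) (mu_B M) \<omega> f)"
definition fac_rB where "fac_rB M \<omega> = (THE f. is_right_factor (base_B M) (mu_B M) \<omega> f)"
definition fac_lC where "fac_lC M \<omega> = (THE f. is_left_factor (base_C M) (mu_C M) \<omega> f)"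
definition fac_rC where "fac_rC M \<omega> = (THE f. is_right_factor (base_C M) (mu_C M) \<omega> f)"

definition ten_pairing ::
  "('a \<Rightarrow> 'a \<Rightarrow> 'd \<Rightarrow> 'd \<Rightarrow> complex) \<Rightarrow> 'a ten \<Rightarrow> 'd ten \<Rightarrow> complex" where
  "ten_pairing P u u' = lin_ext (\<lambda>(p, q). lin_ext (\<lambda>(v, w). P p q v w) u') u"

text \<open>
  \<open>transposes K K' T T' P Q\<close>: the maps induced by \<open>T\<close> and \<open>T'\<close>, with values in the quotients by
  \<open>K\<close> and \<open>K'\<close>, satisfy \<open>P(T u, u') = Q(u, T' u')\<close> for the pairings induced by \<open>P\<close> and \<open>Q\<close>. The
  quantification over representatives of \<open>T u\<close> and \<open>T' u'\<close> includes that the values do not depend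
  on these.
\<close>

definition transposes where
  "transposes K K' T T' P Q \<longleftrightarrow>
     (\<forall>u u' v v'. v - T u \<in> K \<longrightarrow> v' - T' u' \<in> K' \<longrightarrow> ten_pairing P v u' = ten_pairing Q u v')"

text \<open>
  The total algebra \<open>A'\<close> of the dual is the type \<open>'d\<close>, identified with the space of functionals
  \<open>dual_space M\<close> by the bijection \<open>ev\<close>. Since \<open>A'\<close> is a regular multiplier Hopf algebroid, its maps
  \<open>t_B\<close> and \<open>t_C\<close> are the inverses of the restrictions of its antipode.
\<close>

definition is_dual ::
  "('a::complex_algebra, 'm) measured_hopf_algebroid_scheme \<Rightarrow>
   ('d::complex_algebra, 'n) hopf_algebroid_scheme \<Rightarrow> ('d \<Rightarrow> 'a \<Rightarrow> complex) \<Rightarrow> bool" where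
  "is_dual M A' ev \<longleftrightarrow>
     regular_multiplier_hopf_algebroid A' \<and>
     clinear ev \<and> bij_betw ev UNIV (dual_space M) \<and>
     (\<forall>\<upsilon> \<omega> b\<omega> a b. ev b\<omega> = (\<lambda>a. ev \<omega> (a * b)) \<longrightarrow>
        sends (ker_upC_lowC M)
          (\<lambda>(p, q). mu_C M (S_ext M (fac_lB M (ev \<upsilon>) p) * fac_lC M (ev \<omega>) q))
          (Delta_C_2 M a b) (ev (\<upsilon> * b\<omega>) a)) \<and>
     (\<exists>\<eta>\<^sub>B \<eta>\<^sub>C.
        injective_homomorphism (base_B M) \<eta>\<^sub>B \<and> injective_homomorphism (base_C M) \<eta>\<^sub>C \<and>
        (\<forall>x\<in>base_B M. \<forall>\<omega>. ev (\<omega> \<lhd> \<eta>\<^sub>B x) = (\<lambda>a. ev \<omega> (x \<rhd> a)) \<and>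
           ev (\<eta>\<^sub>B x \<rhd> \<omega>) = (\<lambda>a. ev \<omega> (inv_into (base_C M) (S_C M) x \<rhd> a))) \<and>
        (\<forall>y\<in>base_C M. \<forall>\<omega>. ev (\<omega> \<lhd> \<eta>\<^sub>C y) = (\<lambda>a. ev \<omega> (a \<lhd> inv_into (base_B M) (S_B M) y)) \<and>
           ev (\<eta>\<^sub>C y \<rhd> \<omega>) = (\<lambda>a. ev \<omega> (a \<lhd> y))) \<and>
        base_B A' = \<eta>\<^sub>C ` base_C M \<and> base_C A' = \<eta>\<^sub>B ` base_B M) \<and>
     (\<forall>\<omega> a. ev (antipode A' \<omega>) a = ev \<omega> (antipode M a)) \<and>
     transposes (ker_upC_lowC M) (ker_lowB_upB A') (canonical_T1 M) (canonical_T2 A')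
       (\<lambda>p q \<upsilon> \<omega>. mu_C M (S_ext M (fac_lB M (ev \<upsilon>) p) * fac_lC M (ev \<omega>) q))
       (\<lambda>p q \<upsilon> \<omega>. mu_B M (fac_rB M (ev \<upsilon>) p * fac_lB M (ev \<omega>) q)) \<and>
     transposes (ker_lowB_upB M) (ker_upC_lowC A') (canonical_T2 M) (canonical_T1 A')
       (\<lambda>p q \<upsilon> \<omega>. mu_B M (fac_rB M (ev \<upsilon>) p * S_ext M (fac_rC M (ev \<omega>) q)))
       (\<lambda>p q \<upsilon> \<omega>. mu_C M (fac_rC M (ev \<upsilon>) p * fac_lC M (ev \<omega>) q))"


section \<open>Pairings\<close>

definition unital_left_action ::
  "('r::complex_algebra \<Rightarrow> 'm::complex_vector \<Rightarrow> 'm) \<Rightarrow> bool" where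
  "unital_left_action l \<longleftrightarrow> cbilinear l \<and> (\<forall>a b m. l (a * b) m = l a (l b m)) \<and>
     cvec.span {l a m | a m. True} = UNIV"

definition unital_right_action ::
  "('m::complex_vector \<Rightarrow> 'r::complex_algebra \<Rightarrow> 'm) \<Rightarrow> bool" where
  "unital_right_action r \<longleftrightarrow> cbilinear r \<and> (\<forall>a b m. r m (a * b) = r (r m a) b) \<and>
     cvec.span {r m a | a m. True} = UNIV"

definition admissible_pairing ::
  "('a::complex_algebra \<Rightarrow> 'd::complex_algebra \<Rightarrow> complex) \<Rightarrow> bool" where
  "admissible_pairing pr \<longleftrightarrow> cbilinear pr \<and>
     (\<forall>a. (\<forall>a'. pr a a' = 0) \<longrightarrow> a = 0) \<and> (\<forall>a'. (\<forall>a. pr a a' = 0) \<longrightarrow> a' = 0) \<and>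
     (\<exists>(r :: 'a \<Rightarrow> 'd \<Rightarrow> 'a) (l :: 'd \<Rightarrow> 'a \<Rightarrow> 'a) (l' :: 'a \<Rightarrow> 'd \<Rightarrow> 'd) (r' :: 'd \<Rightarrow> 'a \<Rightarrow> 'd).
        unital_right_action r \<and> unital_left_action l \<and>
        unital_left_action l' \<and> unital_right_action r' \<and>
        (\<forall>a a' b'. pr a (a' * b') = pr (r a a') b' \<and> pr a (a' * b') = pr (l b' a) a') \<and>
        (\<forall>a b a'. pr (a * b) a' = pr a (l' b a') \<and> pr (a * b) a' = pr b (r' a' a)))"

definition left_density where
  "left_density D \<mu> pr a a' = (THE g. g \<in> D \<and> (\<forall>x\<in>D. pr (x \<rhd> a) a' = \<mu> (x * g)))"
definition right_density where
  "right_density D \<mu> pr a a' = (THE g. g \<in> D \<and> (\<forall>x\<in>D. pr (a \<lhd> x) a' = \<mu> (g * x)))"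

definition multiplier_hopf_algebroid_pairing ::
  "('a::complex_algebra, 'm) hopf_algebroid_scheme \<Rightarrow>
   ('d::complex_algebra, 'n) hopf_algebroid_scheme \<Rightarrow>
   ('a multiplier \<Rightarrow> complex) \<Rightarrow> ('a \<Rightarrow> 'd \<Rightarrow> complex) \<Rightarrow> bool" where
  "multiplier_hopf_algebroid_pairing A A' \<mu>\<^sub>B pr \<longleftrightarrow>
     regular_multiplier_hopf_algebroid A \<and> regular_multiplier_hopf_algebroid A' \<and>
     faithful_functional (base_B A) \<mu>\<^sub>B \<and>
     (\<forall>x\<^sub>1\<in>base_B A. \<forall>x\<in>base_B A. \<mu>\<^sub>B (x\<^sub>1 * x) = \<mu>\<^sub>B (S_ext A (S_ext A x) * x\<^sub>1)) \<and>
     admissible_pairing pr \<and>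
     (\<forall>a a'. pr (antipode A a) a' = pr a (antipode A' a')) \<and>
     (\<exists>\<alpha> \<beta>. anti_isomorphism (base_B A) (base_B A') \<alpha> \<and>
        anti_isomorphism (base_C A) (base_C A') \<beta> \<and>
        (\<forall>x\<in>base_B A. \<forall>a a'. pr (a \<lhd> x) a' = pr a (a' \<lhd> \<alpha> x) \<and>
           pr (x \<rhd> a) a' = pr a (a' \<lhd> S_ext A' (\<alpha> x))) \<and>
        (\<forall>y\<in>base_C A. \<forall>a a'. pr (y \<rhd> a) a' = pr a (\<beta> y \<rhd> a') \<and>
           pr (a \<lhd> y) a' = pr a (S_ext A' (\<beta> y) \<rhd> a'))) \<and>
     (\<forall>a a'. (\<exists>x\<^sub>1\<in>base_B A. \<forall>x\<in>base_B A. pr (x \<rhd> a) a' = \<mu>\<^sub>B (x * x\<^sub>1)) \<and>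
        (\<exists>x\<^sub>2\<in>base_B A. \<forall>x\<in>base_B A. pr (a \<lhd> x) a' = \<mu>\<^sub>B (x\<^sub>2 * x))) \<and>
     (let \<mu>\<^sub>C = (\<lambda>y. \<mu>\<^sub>B (S_ext A y));
          \<gamma>\<^sub>1 = left_density (base_B A) \<mu>\<^sub>B pr; \<gamma>\<^sub>2 = right_density (base_B A) \<mu>\<^sub>B pr;
          \<rho>\<^sub>1 = left_density (base_C A) \<mu>\<^sub>C pr; \<rho>\<^sub>2 = right_density (base_C A) \<mu>\<^sub>C pr
      in transposes (ker_upC_lowC A) (ker_lowB_upB A') (canonical_T1 A) (canonical_T2 A')
           (\<lambda>a b a' b'. \<mu>\<^sub>C (S_ext A (\<gamma>\<^sub>1 a a') * \<rho>\<^sub>1 b b'))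
           (\<lambda>a b a' b'. \<mu>\<^sub>B (\<gamma>\<^sub>2 a a' * \<gamma>\<^sub>1 b b')) \<and>
         transposes (ker_lowB_upB A) (ker_upC_lowC A') (canonical_T2 A) (canonical_T1 A')
           (\<lambda>a b a' b'. \<mu>\<^sub>B (\<gamma>\<^sub>2 a a' * S_ext A (\<rho>\<^sub>2 b b')))
           (\<lambda>a b a' b'. \<mu>\<^sub>C (\<rho>\<^sub>2 a a' * \<rho>\<^sub>1 b b')))"

end

theory Submission
  imports Defs
begin

text \<open>
  A pairing of multiplier Hopf algebroids is formulated with Radon-Nikodym type densities
  \<open>\<gamma>\<^sub>1, \<gamma>\<^sub>2, \<rho>\<^sub>1, \<rho>\<^sub>2\<close>, and for the evaluation pairing these are nothing but the factors
  \<open>\<^sub>B\<omega>(a)\<close>, \<open>\<omega>\<^sub>B(a)\<close>, \<open>\<^sub>C\<omega>(a)\<close>, \<open>\<omega>\<^sub>C(a)\<close> (lemma \<open>densities\<close>). After this identification the two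
  transposition identities are the ones that define the coproduct of the dual, and
  \<open>\<alpha> = \<eta>\<^sub>C \<circ> S\<^sub>B\<close>, \<open>\<beta> = \<eta>\<^sub>B \<circ> S\<^sub>C\<close> are the required anti-isomorphisms of the base algebras
  (\<open>base_isomorphisms\<close>). The work lies in three points.

  The factors exist. Left factors of \<open>\<phi>(\<cdot> c)\<close> come from those of \<open>\<phi>\<close>. Right factors come from the
  antipode of the dual: it is onto, so each functional is \<open>\<omega> \<circ> S\<close> with \<open>\<omega>\<close> in the dual, and
  \<open>S\<close> turns the left factors of \<open>\<omega>\<close> into right factors (\<open>right_factors\<close>).

  The pairing is admissible. The action of \<open>\<upsilon> = \<phi>(\<cdot> c)\<close> on \<open>a\<close> from the right is the slice
  \<open>(S \<circ> \<^sub>B\<Phi> \<otimes> \<iota>)(\<Delta>\<^sub>C(a)(c \<otimes> 1))\<close>, multiplied together (\<open>product_slice\<close>). Slices span \<open>A\<close> because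
  the fourth canonical map and \<open>\<^sub>B\<Phi>\<close> are onto (\<open>slices_span\<close>). The two antipodes carry this action
  to the left action of \<open>A'\<close> on \<open>A\<close>, and the translations \<open>\<omega>(\<cdot> b)\<close> to the translations \<open>\<omega>(b \<cdot>)\<close>.

  The functional \<open>\<mu>\<^sub>B\<close> has the modular property \<open>\<mu>\<^sub>B(x\<^sub>1x) = \<mu>\<^sub>B(S\<^sup>2(x)x\<^sub>1)\<close> (\<open>mu_B_modular\<close>). This is
  forced by \<open>\<mu>\<^sub>B \<circ> \<epsilon>\<^sub>B = \<mu>\<^sub>C \<circ> \<^sub>C\<epsilon>\<close>: the counit \<open>\<epsilon>\<^sub>B\<close> takes the same value at \<open>xa\<close> and at
  \<open>t\<^sub>B(x)a\<close>, whereas \<open>\<^sub>C\<epsilon>\<close> sends these to \<open>\<^sub>C\<epsilon>(a)S(x)\<close> and \<open>t\<^sub>B(x) \<^sub>C\<epsilon>(a)\<close>.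
\<close>

section \<open>Linear maps on free vector spaces and balanced tensor products\<close>

lemma lin_ext_superset:
  assumes "finite F" and "Poly_Mapping.keys u \<subseteq> F"
  shows "lin_ext f u = (\<Sum>k\<in>F. Poly_Mapping.lookup u k *\<^sub>C f k)"
  unfolding lin_ext_def using assms
  by (intro sum.mono_neutral_left) (auto simp: in_keys_iff)

lemma clinear_lin_ext: "clinear (lin_ext f)"
proof (rule clinearI)
  fix u v :: "'a \<Rightarrow>\<^sub>0 complex" and c
  let ?F = "Poly_Mapping.keys u \<union> Poly_Mapping.keys v"
  show "lin_ext f (u + v) = lin_ext f u + lin_ext f v"
    using keys_add[of u v]
    by (simp add: lin_ext_superset[where F = ?F] lookup_add scaleC_add_left sum.distrib)
  have "Poly_Mapping.lookup (c *\<^sub>C u) k = c * Poly_Mapping.lookup u k" for k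
    by transfer (simp add: scaleC_complex_def)
  moreover from this have "Poly_Mapping.keys (c *\<^sub>C u) \<subseteq> Poly_Mapping.keys u"
    by (auto simp: in_keys_iff)
  ultimately show "lin_ext f (c *\<^sub>C u) = c *\<^sub>C lin_ext f u"
    by (simp add: lin_ext_superset[where F = "Poly_Mapping.keys u"] cvec.scale_sum_right
        scaleC_scaleC)
qed

lemma lin_ext_single [simp]: "lin_ext f (Poly_Mapping.single k 1) = f k"
  by (simp add: lin_ext_def scaleC_one)

lemma clinear_module_hom: "clinear f \<Longrightarrow> module_hom scaleC scaleC f"
  by (simp add: Vector_Spaces.linear_def)

lemmas clinear_diff = module_hom.diff[OF clinear_module_hom]
lemmas clinear_0 = module_hom.zero[OF clinear_module_hom]
lemmas clinear_sum = module_hom.sum[OF clinear_module_hom]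

lemmas lin_ext_add = clinearD(1)[OF clinear_lin_ext]
lemmas lin_ext_scaleC = clinearD(2)[OF clinear_lin_ext]
lemmas lin_ext_diff = clinear_diff[OF clinear_lin_ext]

lemma clinear_compose_lin_ext:
  assumes "clinear F"
  shows "F (lin_ext f u) = lin_ext (\<lambda>k. F (f k)) u"
  by (simp add: lin_ext_def clinear_sum[OF assms] clinearD(2)[OF assms])

lemma lin_ext_cong: "(\<And>k. f k = g k) \<Longrightarrow> lin_ext f u = lin_ext g u"
  by (simp add: lin_ext_def)

lemma lin_ext_in_span: "lin_ext f u \<in> cvec.span (range f)"
  unfolding lin_ext_def by (intro cvec.span_sum cvec.span_scale cvec.span_base rangeI)

lemma clinear_tensor_map: "clinear (tensor_map f g)"
  unfolding tensor_map_def by (rule clinear_lin_ext)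

lemma tensor_map_pure [simp]: "tensor_map f g (pure a b) = pure (f a) (g b)"
  by (simp add: tensor_map_def)

lemma lin_ext_tensor_map: "lin_ext h (tensor_map f g u) = lin_ext (\<lambda>(p, q). h (f p, g q)) u"
  unfolding tensor_map_def clinear_compose_lin_ext[OF clinear_lin_ext]
  by (intro lin_ext_cong) auto

lemma tensor_map_tensor_map:
  "tensor_map f g (tensor_map f' g' u) = tensor_map (f \<circ> f') (g \<circ> g') u"
  by (simp add: tensor_map_def[of f g] lin_ext_tensor_map)
    (auto simp: tensor_map_def intro!: lin_ext_cong)

lemma clinear_comp: "clinear f \<Longrightarrow> clinear g \<Longrightarrow> clinear (\<lambda>x. f (g x))"
  by (rule clinearI) (auto simp: clinearD)

lemma clinear_span_zero:
  assumes "clinear F" and "\<And>x. x \<in> X \<Longrightarrow> F x = 0" and "u \<in> cvec.span X"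
  shows "F u = 0"
  using assms(3)
  by (induction rule: cvec.span_induct_alt)
    (auto simp: clinear_0[OF assms(1)] clinearD[OF assms(1)] assms(2))

lemma clinear_eq_on_span:
  assumes "clinear F" "clinear G" and "\<And>x. x \<in> X \<Longrightarrow> F x = G x" and "u \<in> cvec.span X"
  shows "F u = G u"
proof -
  have "clinear (\<lambda>x. F x - G x)"
    by (rule clinearI)
      (auto simp: clinearD[OF assms(1)] clinearD[OF assms(2)] cvec.scale_right_diff_distrib)
  from clinear_span_zero[OF this _ assms(4)] assms(3) show ?thesis by auto
qed

lemma clinear_image_span:
  assumes "clinear F" and "\<And>x. x \<in> X \<Longrightarrow> F x \<in> cvec.span Y" and "u \<in> cvec.span X"
  shows "F u \<in> cvec.span Y"
  using assms(3)
  by (induction rule: cvec.span_induct_alt)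
    (auto simp: clinear_0[OF assms(1)] clinearD[OF assms(1)]
      intro!: cvec.span_zero cvec.span_add cvec.span_scale assms(2))

lemma clinear_linear_on_comp:
  "clinear f \<Longrightarrow> range f \<subseteq> D \<Longrightarrow> linear_on D g \<Longrightarrow> clinear (\<lambda>x. g (f x))"
  by (rule clinearI) (auto simp: clinearD linear_on_def subset_iff)

lemma subspace_of_span_UNIV:
  assumes "cvec.span X = UNIV" and "cvec.subspace V" and "\<And>x. x \<in> X \<Longrightarrow> x \<in> V"
  shows "a \<in> V"
  using cvec.span_minimal[of X V] assms by blast

lemma subspace_vimage: "clinear f \<Longrightarrow> cvec.subspace V \<Longrightarrow> cvec.subspace {x. f x \<in> V}"
  by (auto simp: cvec.subspace_def clinearD clinear_0)

lemma cbilinearI: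
  assumes "\<And>a. clinear (f a)" and "\<And>b. clinear (\<lambda>a. f a b)"
  shows "cbilinear f"
  using assms by (simp add: cbilinear_def)

text \<open>
  The universal property of a balanced tensor product, in terms of representatives.
\<close>

lemma lin_ext_tensor_kernel_zero:
  fixes f :: "'a::complex_vector \<Rightarrow> 'a \<Rightarrow> 'v::complex_vector"
  assumes f: "cbilinear f"
    and bal: "\<And>a b a' b'. ((a, b), (a', b')) \<in> r \<Longrightarrow> f a b = f a' b'"
    and u: "u \<in> tensor_kernel r"
  shows "lin_ext (\<lambda>(p, q). f p q) u = 0"
proof (rule clinear_span_zero[OF clinear_lin_ext _ u[unfolded tensor_kernel_def]])
  have lin: "clinear (f a)" "clinear (\<lambda>a. f a b)" for a b
    using f by (auto simp: cbilinear_def)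
  fix x :: "'a ten"
  assume "x \<in> bilinear_relators \<union> {pure a b - pure a' b' |a b a' b'. ((a, b), a', b') \<in> r}"
  then show "lin_ext (\<lambda>(p, q). f p q) x = 0"
    by (auto simp: bilinear_relators_def lin_ext_diff lin_ext_scaleC clinearD[OF lin(1)]
        clinearD[OF lin(2)] dest!: bal)
qed

lemma tensor_kernel_relators:
  shows "((a, b), (a', b')) \<in> r \<Longrightarrow> pure a b - pure a' b' \<in> tensor_kernel r"
    and "pure (a + a') b - pure a b - pure a' b \<in> tensor_kernel r"
    and "pure a (b + b') - pure a b - pure a b' \<in> tensor_kernel r"
    and "pure (c *\<^sub>C a) b - c *\<^sub>C pure a b \<in> tensor_kernel r"
    and "pure a (c *\<^sub>C b) - c *\<^sub>C pure a b \<in> tensor_kernel r"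
  unfolding tensor_kernel_def bilinear_relators_def by (intro cvec.span_base; blast)+

lemma tensor_map_tensor_kernel:
  assumes f: "clinear f" and g: "clinear g"
    and bal: "\<And>a b a' b'. ((a, b), (a', b')) \<in> r \<Longrightarrow> ((f a, g b), (f a', g b')) \<in> r"
    and u: "u \<in> tensor_kernel r"
  shows "tensor_map f g u \<in> tensor_kernel r"
proof -
  have "tensor_map f g u \<in> cvec.span (tensor_kernel r)"
  proof (rule clinear_image_span[OF clinear_tensor_map _ u[unfolded tensor_kernel_def]])
    fix x :: "'a ten"
    assume "x \<in> bilinear_relators \<union> {pure a b - pure a' b' |a b a' b'. ((a, b), a', b') \<in> r}"
    then have "tensor_map f g x \<in> tensor_kernel r"
      unfolding bilinear_relators_def Un_iff mem_Collect_eq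
      by (elim disjE exE conjE; hypsubst)
        (simp only: clinear_diff[OF clinear_tensor_map] clinearD(2)[OF clinear_tensor_map]
          clinearD[OF f] clinearD[OF g] tensor_map_pure;
          intro tensor_kernel_relators bal; assumption?)+
    then show "tensor_map f g x \<in> cvec.span (tensor_kernel r)" by (rule cvec.span_base)
  qed
  then show ?thesis by (simp add: tensor_kernel_def cvec.span_span)
qed

lemma tensor_kernel_subspace: "cvec.subspace (tensor_kernel r)"
  unfolding tensor_kernel_def by (rule cvec.subspace_span)

section \<open>Multipliers\<close>

lemma clinear_mult_left: "clinear (mult_left m)"
  by transfer auto
lemma clinear_mult_right: "clinear (\<lambda>a. a \<lhd> m)"
  by transfer (auto simp: eta_contract_eq)
lemma mult_left_mult: "m \<rhd> (a * b) = (m \<rhd> a) * b"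
  by transfer auto
lemma mult_right_mult: "(a * b) \<lhd> m = a * (b \<lhd> m)"
  by transfer auto
lemma mult_mult_left: "a * (m \<rhd> b) = (a \<lhd> m) * b"
  by transfer auto
lemma times_mult_left: "(m * n) \<rhd> a = m \<rhd> n \<rhd> a"
  by transfer auto
lemma clinear_multiplier_left: "clinear (\<lambda>m. m \<rhd> a)"
  by (rule clinearI; transfer; auto)
lemma multiplier_eqI:
  "(\<And>a. m \<rhd> a = n \<rhd> a) \<Longrightarrow> (\<And>a. a \<lhd> m = a \<lhd> n) \<Longrightarrow> m = n"
  by transfer (auto simp: fun_eq_iff prod_eq_iff)

lemma clinear_times_left: "clinear (\<lambda>b::'a::complex_algebra. a * b)"
  by (rule clinearI) (auto simp: algebra_simps scaleC_mult_right)
lemma clinear_times_right: "clinear (\<lambda>b::'a::complex_algebra. b * a)"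
  by (rule clinearI) (auto simp: algebra_simps scaleC_mult_left)

lemma nondegenerate_zero:
  fixes a :: "'a::complex_algebra"
  assumes "nondegenerate_on (UNIV :: 'a set)"
  shows "(\<And>b. a * b = 0) \<Longrightarrow> a = 0" and "(\<And>b. b * a = 0) \<Longrightarrow> a = 0"
  using assms unfolding nondegenerate_on_def by blast+

text \<open>
  In a non-degenerate algebra \<open>a(mb) = (am)b\<close> recovers the right action from the left one.
\<close>

lemma multiplier_eqI_left:
  fixes m :: "'a::complex_algebra multiplier"
  assumes nd: "nondegenerate_on (UNIV :: 'a set)" and eq: "\<And>a. m \<rhd> a = n \<rhd> a"
  shows "m = n"
proof (rule multiplier_eqI[OF eq])
  fix a
  have "(a \<lhd> m - a \<lhd> n) * b = 0" for b
    by (simp only: left_diff_distrib eq diff_self flip: mult_mult_left)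
  then have "a \<lhd> m - a \<lhd> n = 0" by (rule nondegenerate_zero(1)[OF nd])
  then show "a \<lhd> m = a \<lhd> n" by simp
qed

lemma anti_extension_eq:
  assumes "surj S" and "\<And>a. S (m \<rhd> a) = S a \<lhd> n" and "\<And>a. S (a \<lhd> m) = n \<rhd> S a"
  shows "anti_extension S m = n"
  unfolding anti_extension_def
proof (rule the_equality)
  fix n'
  assume *: "\<forall>a. S (m \<rhd> a) = S a \<lhd> n' \<and> S (a \<lhd> m) = n' \<rhd> S a"
  show "n' = n"
  proof (rule multiplier_eqI)
    fix b
    obtain a where "b = S a" using assms(1) by blast
    with * assms show "n' \<rhd> b = n \<rhd> b" "b \<lhd> n' = b \<lhd> n" by metis+
  qed
qed (use assms in auto)

text \<open>
  Transporting the two actions of \<open>m\<close> along \<open>S\<close> and exchanging them yields a multiplier, so the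
  description that defines the extension of \<open>S\<close> is satisfied.
\<close>

lemma anti_extension_mult:
  assumes S: "anti_isomorphism UNIV UNIV S"
  shows "S (m \<rhd> a) = S a \<lhd> anti_extension S m" and "S (a \<lhd> m) = anti_extension S m \<rhd> S a"
proof -
  have bij: "bij S" and lin: "clinear S" and anti: "\<And>a b. S (a * b) = S b * S a"
    using S by (auto simp: anti_isomorphism_def linear_on_def intro!: clinearI)
  define T where "T = inv S"
  have TS: "T (S a) = a" and ST: "S (T a) = a" for a
    using bij by (simp_all add: T_def bij_is_inj bij_is_surj surj_f_inv_f)
  have T_add: "T (a + b) = T a + T b" and T_scale: "T (c *\<^sub>C a) = c *\<^sub>C T a"
    and T_mult: "T (a * b) = T b * T a" for a b c
    by (metis TS ST clinearD(1)[OF lin], metis TS ST clinearD(2)[OF lin], metis TS ST anti)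
  let ?n = "(\<lambda>a. S (T a \<lhd> m), \<lambda>a. S (m \<rhd> T a))"
  have *: "?n \<in> {m. case m of (L, R) \<Rightarrow>
      clinear L \<and> clinear R \<and> (\<forall>a b. L (a * b) = L a * b) \<and>
      (\<forall>a b. R (a * b) = a * R b) \<and> (\<forall>a b. a * L b = R a * b)}"
  proof (clarsimp, intro conjI allI)
    show "clinear (\<lambda>a. S (T a \<lhd> m))" "clinear (\<lambda>a. S (m \<rhd> T a))"
      by (rule clinearI; simp add: T_add T_scale clinearD[OF lin] clinearD[OF clinear_mult_left]
          clinearD[OF clinear_mult_right])+
  next
    fix a b
    show "S (T (a * b) \<lhd> m) = S (T a \<lhd> m) * b"
      by (simp add: T_mult mult_right_mult anti ST)
    show "S (m \<rhd> T (a * b)) = a * S (m \<rhd> T b)"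
      by (simp add: T_mult mult_left_mult anti ST)
    have "a * S (T b \<lhd> m) = S ((T b \<lhd> m) * T a)" by (simp add: anti ST)
    also have "\<dots> = S (T b * (m \<rhd> T a))" by (simp add: mult_mult_left)
    finally show "a * S (T b \<lhd> m) = S (m \<rhd> T a) * b" by (simp add: anti ST)
  qed
  define n where "n = Abs_multiplier ?n"
  have "Rep_multiplier n = ?n" unfolding n_def by (rule Abs_multiplier_inverse[OF *])
  then have n: "n \<rhd> a = S (T a \<lhd> m)" "a \<lhd> n = S (m \<rhd> T a)" for a
    by (simp_all add: mult_left.rep_eq[of n] mult_right.rep_eq[of _ n])
  have "anti_extension S m = n"
    by (rule anti_extension_eq) (simp_all add: n TS bij bij_is_surj)
  then show "S (m \<rhd> a) = S a \<lhd> anti_extension S m" "S (a \<lhd> m) = anti_extension S m \<rhd> S a"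
    by (simp_all add: n TS)
qed

section \<open>Faithful functionals and densities\<close>

lemma linear_on_diff:
  assumes "linear_on D f" and "cvec.subspace D" and "u \<in> D" and "v \<in> D"
  shows "f (u - v) = f u - f v"
proof -
  have "(-1) *\<^sub>C v \<in> D" by (intro cvec.subspace_scale assms)
  then have "f (u + (-1) *\<^sub>C v) = f u + (-1) *\<^sub>C f v"
    using assms by (simp only: linear_on_def)
  then show ?thesis by simp
qed

lemma faithful_cancel:
  assumes "faithful_functional D \<mu>" and "subalgebra D" and "g \<in> D" and "g' \<in> D"
  shows "(\<And>x. x \<in> D \<Longrightarrow> \<mu> (x * g) = \<mu> (x * g')) \<Longrightarrow> g = g'"
    and "(\<And>x. x \<in> D \<Longrightarrow> \<mu> (g * x) = \<mu> (g' * x)) \<Longrightarrow> g = g'"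
proof -
  have lin: "linear_on D \<mu>" and sub: "cvec.subspace D" and mul: "\<And>x y. x \<in> D \<Longrightarrow> y \<in> D \<Longrightarrow> x * y \<in> D"
    using assms by (auto simp: faithful_functional_def subalgebra_def)
  have D: "g - g' \<in> D" using sub assms by (simp add: cvec.subspace_diff)
  {
    assume eq: "\<And>x. x \<in> D \<Longrightarrow> \<mu> (x * g) = \<mu> (x * g')"
    have "\<mu> (x * (g - g')) = 0" if "x \<in> D" for x
      using that assms
      by (simp add: right_diff_distrib linear_on_diff[OF lin sub] mul eq)
    with D assms(1) show "g = g'" by (auto simp: faithful_functional_def)
  next
    assume eq: "\<And>x. x \<in> D \<Longrightarrow> \<mu> (g * x) = \<mu> (g' * x)"
    have "\<mu> ((g - g') * x) = 0" if "x \<in> D" for x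
      using that assms
      by (simp add: left_diff_distrib linear_on_diff[OF lin sub] mul eq)
    with D assms(1) show "g = g'" by (auto simp: faithful_functional_def)
  }
qed

lemma left_factor_unique:
  assumes "faithful_functional D \<mu>" and "subalgebra D"
    and "is_left_factor D \<mu> \<omega> f" and "is_left_factor D \<mu> \<omega> g"
  shows "f = g"
proof
  fix a
  show "f a = g a"
  proof (rule faithful_cancel(1)[OF assms(1,2)])
    show "f a \<in> D" "g a \<in> D" using assms by (auto simp: is_left_factor_def)
    fix x assume "x \<in> D"
    then have "\<mu> (x * h a) = \<omega> (x \<rhd> a)" if "is_left_factor D \<mu> \<omega> h" for h
      using that by (simp add: is_left_factor_def)
    with assms(3,4) show "\<mu> (x * f a) = \<mu> (x * g a)" by simp
  qed
qed

lemma right_factor_unique: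
  assumes "faithful_functional D \<mu>" and "subalgebra D"
    and "is_right_factor D \<mu> \<omega> f" and "is_right_factor D \<mu> \<omega> g"
  shows "f = g"
proof
  fix a
  show "f a = g a"
  proof (rule faithful_cancel(2)[OF assms(1,2)])
    show "f a \<in> D" "g a \<in> D" using assms by (auto simp: is_right_factor_def)
    fix x assume "x \<in> D"
    then have "\<mu> (h a * x) = \<omega> (a \<lhd> x)" if "is_right_factor D \<mu> \<omega> h" for h
      using that by (simp add: is_right_factor_def)
    with assms(3,4) show "\<mu> (f a * x) = \<mu> (g a * x)" by simp
  qed
qed

lemma the_left_factor:
  assumes "faithful_functional D \<mu>" and "subalgebra D" and "is_left_factor D \<mu> \<omega> f"
  shows "is_left_factor D \<mu> \<omega> (THE f. is_left_factor D \<mu> \<omega> f)"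
  by (rule theI[where a = f]) (rule assms(3), rule left_factor_unique[OF assms(1,2) _ assms(3)])

lemma the_right_factor:
  assumes "faithful_functional D \<mu>" and "subalgebra D" and "is_right_factor D \<mu> \<omega> f"
  shows "is_right_factor D \<mu> \<omega> (THE f. is_right_factor D \<mu> \<omega> f)"
  by (rule theI[where a = f]) (rule assms(3), rule right_factor_unique[OF assms(1,2) _ assms(3)])

text \<open>
  The density of \<open>x \<mapsto> \<omega>(xa)\<close> is the value at \<open>a\<close> of the left factor of \<open>\<omega>\<close>. The second functional
  \<open>\<mu>'\<close> allows for \<open>\<mu>\<^sub>B \<circ> S\<close>, which is compared with \<open>\<mu>\<^sub>C\<close> on \<open>C\<close> alone.
\<close>

lemma left_density_eq:
  assumes "faithful_functional D \<mu>" and "subalgebra D"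
    and "is_left_factor D \<mu> (ev \<omega>) f" and "\<And>y. y \<in> D \<Longrightarrow> \<mu>' y = \<mu> y"
  shows "left_density D \<mu>' (\<lambda>a \<omega>. ev \<omega> a) a \<omega> = f a"
  unfolding left_density_def
proof (rule the_equality)
  have mul: "\<And>x y. x \<in> D \<Longrightarrow> y \<in> D \<Longrightarrow> x * y \<in> D"
    using assms by (auto simp: subalgebra_def)
  have f: "f a \<in> D" using assms by (auto simp: is_left_factor_def)
  show 1: "f a \<in> D \<and> (\<forall>x\<in>D. ev \<omega> (x \<rhd> a) = \<mu>' (x * f a))"
    using f assms mul by (auto simp: is_left_factor_def)
  fix g assume g: "g \<in> D \<and> (\<forall>x\<in>D. ev \<omega> (x \<rhd> a) = \<mu>' (x * g))"
  show "g = f a"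
    by (rule faithful_cancel(1)[OF assms(1,2)]) (use g f 1 assms mul in metis)+
qed

lemma right_density_eq:
  assumes "faithful_functional D \<mu>" and "subalgebra D"
    and "is_right_factor D \<mu> (ev \<omega>) f" and "\<And>y. y \<in> D \<Longrightarrow> \<mu>' y = \<mu> y"
  shows "right_density D \<mu>' (\<lambda>a \<omega>. ev \<omega> a) a \<omega> = f a"
  unfolding right_density_def
proof (rule the_equality)
  have mul: "\<And>x y. x \<in> D \<Longrightarrow> y \<in> D \<Longrightarrow> x * y \<in> D"
    using assms by (auto simp: subalgebra_def)
  have f: "f a \<in> D" using assms by (auto simp: is_right_factor_def)
  show 1: "f a \<in> D \<and> (\<forall>x\<in>D. ev \<omega> (a \<lhd> x) = \<mu>' (f a * x))"
    using f assms mul by (auto simp: is_right_factor_def)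
  fix g assume g: "g \<in> D \<and> (\<forall>x\<in>D. ev \<omega> (a \<lhd> x) = \<mu>' (g * x))"
  show "g = f a"
    by (rule faithful_cancel(2)[OF assms(1,2)]) (use g f 1 assms mul in metis)+
qed

section \<open>Actions defined by adjunction\<close>

text \<open>
  A map that is adjoint to multiplication under a form separating points is automatically an
  action; only spanning has to be checked by hand.
\<close>

lemma unital_left_action_by_adjunction:
  fixes P :: "'r::complex_algebra \<Rightarrow> 'm::complex_vector \<Rightarrow> complex"
  assumes P: "cbilinear P" and sep: "\<And>m n. (\<And>s. P s m = P s n) \<Longrightarrow> m = n"
    and adj: "\<And>s u m. P s (l u m) = P (s * u) m"
    and span: "\<And>V m. cvec.subspace V \<Longrightarrow> (\<And>u m. l u m \<in> V) \<Longrightarrow> m \<in> V"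
  shows "unital_left_action l"
  unfolding unital_left_action_def
proof (intro conjI allI)
  have lin: "clinear (P s)" "clinear (\<lambda>s. P s m)" for s m
    using P by (auto simp: cbilinear_def)
  show "cbilinear l"
    by (intro cbilinearI clinearI; rule sep)
      (simp_all add: adj clinearD[OF lin(1)] clinearD[OF lin(2)] distrib_left scaleC_mult_right)
  show "l (a * b) m = l a (l b m)" for a b m
    by (rule sep) (simp add: adj mult.assoc)
  have "m \<in> cvec.span {l a m | a m. True}" for m
    by (rule span) (auto intro: cvec.span_base)
  then show "cvec.span {l a m | a m. True} = UNIV" by auto
qed

lemma unital_right_action_by_adjunction:
  fixes P :: "'r::complex_algebra \<Rightarrow> 'm::complex_vector \<Rightarrow> complex"
  assumes P: "cbilinear P" and sep: "\<And>m n. (\<And>s. P s m = P s n) \<Longrightarrow> m = n"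
    and adj: "\<And>s u m. P s (r m u) = P (u * s) m"
    and span: "\<And>V m. cvec.subspace V \<Longrightarrow> (\<And>m u. r m u \<in> V) \<Longrightarrow> m \<in> V"
  shows "unital_right_action r"
  unfolding unital_right_action_def
proof (intro conjI allI)
  have lin: "clinear (P s)" "clinear (\<lambda>s. P s m)" for s m
    using P by (auto simp: cbilinear_def)
  show "cbilinear r"
    by (intro cbilinearI clinearI; rule sep)
      (simp_all add: adj clinearD[OF lin(1)] clinearD[OF lin(2)] distrib_right scaleC_mult_left)
  show "r m (a * b) = r (r m a) b" for a b m
    by (rule sep) (simp add: adj mult.assoc)
  have "m \<in> cvec.span {r m a | a m. True}" for m
    by (rule span) (auto intro: cvec.span_base)
  then show "cvec.span {r m a | a m. True} = UNIV" by auto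
qed

section \<open>Regular multiplier Hopf algebroids\<close>

lemma anti_isomorphism_inv_into:
  assumes f: "anti_isomorphism D E f" and D: "subalgebra D"
  shows "anti_isomorphism E D (inv_into D f)"
proof -
  let ?g = "inv_into D f"
  have bij: "bij_betw f D E" and lin: "linear_on D f"
    and anti: "\<And>x x'. x \<in> D \<Longrightarrow> x' \<in> D \<Longrightarrow> f (x * x') = f x' * f x"
    using f by (auto simp: anti_isomorphism_def)
  have gf: "?g (f x) = x" if "x \<in> D" for x
    using bij that by (simp add: bij_betw_inv_into_left)
  have E: "\<exists>x\<in>D. y = f x" if "y \<in> E" for y
    using bij that by (auto simp: bij_betw_def)
  have cl: "x + x' \<in> D" "c *\<^sub>C x \<in> D" "x * x' \<in> D" if "x \<in> D" "x' \<in> D" for x x' c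
    using D that by (auto simp: subalgebra_def cvec.subspace_def)
  have "?g (y + y') = ?g y + ?g y'" "?g (c *\<^sub>C y) = c *\<^sub>C ?g y" "?g (y * y') = ?g y' * ?g y"
    if y: "y \<in> E" "y' \<in> E" for y y' c
  proof -
    obtain x x' where x: "x \<in> D" "x' \<in> D" "y = f x" "y' = f x'" using E y by meson
    have "y + y' = f (x + x')" "c *\<^sub>C y = f (c *\<^sub>C x)" "y * y' = f (x' * x)"
      using x lin anti by (auto simp: linear_on_def)
    then show "?g (y + y') = ?g y + ?g y'" "?g (c *\<^sub>C y) = c *\<^sub>C ?g y"
      "?g (y * y') = ?g y' * ?g y"
      using x by (simp_all add: gf cl)
  qed
  then show ?thesis
    by (simp add: anti_isomorphism_def linear_on_def bij_betw_inv_into[OF bij])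
qed

lemma sends_value: "sends K f w v \<Longrightarrow> cvec.subspace K \<Longrightarrow> lin_ext f w = v"
  by (simp add: sends_def cvec.subspace_0)

lemma sends_kernel:
  assumes "sends K f w v" and "cvec.subspace K" and "k \<in> K"
  shows "lin_ext f k = 0"
proof -
  have "lin_ext f (w + k) = v" using assms by (simp add: sends_def)
  with sends_value[OF assms(1,2)] show ?thesis by (simp add: lin_ext_add)
qed

text \<open>
  A map that descends to a balanced tensor product is itself balanced. The two \<open>C\<close>-linearity rules
  of \<open>\<^sub>C\<epsilon>\<close> are read off from the counit axioms in this way.
\<close>

lemma sends_balanced:
  assumes "sends (tensor_kernel r) f w v" and "((a, b), (a', b')) \<in> r"
  shows "f (a, b) = f (a', b')"
  using sends_kernel[OF assms(1) tensor_kernel_subspace tensor_kernel_relators(1)[OF assms(2)]]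
  by (simp add: lin_ext_diff)

locale regular_hopf_algebroid =
  fixes H :: "('a::complex_algebra, 'm) hopf_algebroid_scheme"
  assumes regular: "regular_multiplier_hopf_algebroid H"
begin

abbreviation "B \<equiv> base_B H"
abbreviation "C \<equiv> base_C H"
abbreviation "S \<equiv> antipode H"
abbreviation "K \<equiv> ker_upC_lowC H"

lemma base: "base_algebras H" and counits: "counits_and_antipode H"
  and comult_C: "comultiplication_C H" and nondeg_tensors: "nondegenerate_tensors H"
  and canonical: "canonical_maps_bijective H"
  using regular by (auto simp: regular_multiplier_hopf_algebroid_def)

lemma nondeg: "nondegenerate_on (UNIV :: 'a set)"
  using base by (simp add: base_algebras_def)

lemma span_products: "cvec.span {a * b | a b :: 'a. True} = UNIV"
  using base by (simp add: base_algebras_def idempotent_algebra_def)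

lemma subalgebra_B: "subalgebra B" and subalgebra_C: "subalgebra C"
  using base by (simp_all add: base_algebras_def)

lemma mult_B: "x \<in> B \<Longrightarrow> x' \<in> B \<Longrightarrow> x * x' \<in> B" and mult_C: "y \<in> C \<Longrightarrow> y' \<in> C \<Longrightarrow> y * y' \<in> C"
  using subalgebra_B subalgebra_C by (auto simp: subalgebra_def)

lemma commute: "x \<in> B \<Longrightarrow> y \<in> C \<Longrightarrow> x * y = y * x"
  using base by (auto simp: base_algebras_def)

lemma anti_t_B: "anti_isomorphism B C (t_B H)" and anti_t_C: "anti_isomorphism C B (t_C H)"
  using base by (auto simp: base_algebras_def)

lemma anti_S_B: "anti_isomorphism B C (S_B H)" and anti_S_C: "anti_isomorphism C B (S_C H)"
  unfolding S_B_def S_C_def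
  by (rule anti_isomorphism_inv_into anti_t_B anti_t_C subalgebra_B subalgebra_C)+

lemma base_maps_in:
  "x \<in> B \<Longrightarrow> t_B H x \<in> C" "y \<in> C \<Longrightarrow> t_C H y \<in> B" "x \<in> B \<Longrightarrow> S_B H x \<in> C" "y \<in> C \<Longrightarrow> S_C H y \<in> B"
  using anti_t_B anti_t_C anti_S_B anti_S_C
  by (auto simp: anti_isomorphism_def dest: bij_betw_apply)

lemma base_maps_mult:
  "x \<in> B \<Longrightarrow> x' \<in> B \<Longrightarrow> t_B H (x * x') = t_B H x' * t_B H x"
  "y \<in> C \<Longrightarrow> y' \<in> C \<Longrightarrow> t_C H (y * y') = t_C H y' * t_C H y"
  "x \<in> B \<Longrightarrow> x' \<in> B \<Longrightarrow> S_B H (x * x') = S_B H x' * S_B H x"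
  "y \<in> C \<Longrightarrow> y' \<in> C \<Longrightarrow> S_C H (y * y') = S_C H y' * S_C H y"
  using anti_t_B anti_t_C anti_S_B anti_S_C by (auto simp: anti_isomorphism_def)

lemma base_maps_inverse:
  "x \<in> B \<Longrightarrow> S_C H (t_B H x) = x" "y \<in> C \<Longrightarrow> t_B H (S_C H y) = y"
  "y \<in> C \<Longrightarrow> S_B H (t_C H y) = y" "x \<in> B \<Longrightarrow> t_C H (S_B H x) = x"
  using anti_t_B anti_t_C
  by (auto simp: anti_isomorphism_def S_B_def S_C_def bij_betw_inv_into_left bij_betw_inv_into_right)

lemma inv_into_S_B: "y \<in> C \<Longrightarrow> inv_into B (S_B H) y = t_C H y"
  using bij_betw_inv_into_left[of "S_B H" B C "t_C H y"] anti_S_B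
  by (simp add: anti_isomorphism_def base_maps_in base_maps_inverse)

lemma inv_into_S_C: "x \<in> B \<Longrightarrow> inv_into C (S_C H) x = t_B H x"
  using bij_betw_inv_into_left[of "S_C H" C B "t_B H x"] anti_S_C
  by (simp add: anti_isomorphism_def base_maps_in base_maps_inverse)

lemma anti_antipode: "anti_isomorphism UNIV UNIV S"
  using counits by (simp add: counits_and_antipode_def)

lemma bij_antipode: "bij S" and clinear_antipode: "clinear S"
  and antipode_mult: "S (a * b) = S b * S a"
  using anti_antipode by (auto simp: anti_isomorphism_def linear_on_def intro!: clinearI)

lemma S_ext_B: "x \<in> B \<Longrightarrow> S_ext H x = S_B H x" and S_ext_C: "y \<in> C \<Longrightarrow> S_ext H y = S_C H y"
  using counits by (simp_all add: counits_and_antipode_def)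

lemma antipode_actions:
  shows "x \<in> B \<Longrightarrow> S (x \<rhd> a) = S a \<lhd> S_B H x" "x \<in> B \<Longrightarrow> S (a \<lhd> x) = S_B H x \<rhd> S a"
    and "y \<in> C \<Longrightarrow> S (y \<rhd> a) = S a \<lhd> S_C H y" "y \<in> C \<Longrightarrow> S (a \<lhd> y) = S_C H y \<rhd> S a"
  using anti_extension_mult[OF anti_antipode] S_ext_B S_ext_C by (simp_all add: S_ext_def)

lemma left_right_commute: "(m \<rhd> a) \<lhd> n = m \<rhd> (a \<lhd> n)" for a :: 'a
proof -
  (* both sides of the difference become ((c m) a) n *)
  have "c * ((m \<rhd> a) \<lhd> n - m \<rhd> (a \<lhd> n)) = 0" for c
    by (simp only: right_diff_distrib mult_mult_left flip: mult_right_mult) simp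
  then have "(m \<rhd> a) \<lhd> n - m \<rhd> (a \<lhd> n) = 0" by (rule nondegenerate_zero(2)[OF nondeg])
  then show ?thesis by simp
qed

lemma spanned_by_base_action:
  assumes V: "cvec.subspace V"
  shows "(\<And>a x. x \<in> B \<Longrightarrow> a \<lhd> x \<in> V) \<Longrightarrow> a \<in> V" and "(\<And>a y. y \<in> C \<Longrightarrow> a \<lhd> y \<in> V) \<Longrightarrow> a \<in> V"
    and "(\<And>a x. x \<in> B \<Longrightarrow> x \<rhd> a \<in> V) \<Longrightarrow> a \<in> V" and "(\<And>a y. y \<in> C \<Longrightarrow> y \<rhd> a \<in> V) \<Longrightarrow> a \<in> V"
  using base unfolding base_algebras_def by (auto intro: subspace_of_span_UNIV[OF _ V])

lemma spanned_by_base_bimodule: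
  assumes V: "cvec.subspace V"
    and gen: "\<And>x y x' y' a. x \<in> B \<Longrightarrow> y \<in> C \<Longrightarrow> x' \<in> B \<Longrightarrow> y' \<in> C \<Longrightarrow> (x \<rhd> y \<rhd> a) \<lhd> x' \<lhd> y' \<in> V"
  shows "a \<in> V"
proof (rule spanned_by_base_action(2)[OF V])
  fix a y' assume y': "y' \<in> C"
  have V1: "cvec.subspace {a. a \<lhd> y' \<in> V}"
    by (rule subspace_vimage[OF clinear_mult_right V])
  have "a \<in> {a. a \<lhd> y' \<in> V}"
  proof (rule spanned_by_base_action(1)[OF V1])
    fix a x' assume x': "x' \<in> B"
    have V2: "cvec.subspace {a. a \<lhd> x' \<in> {a. a \<lhd> y' \<in> V}}"
      by (rule subspace_vimage[OF clinear_mult_right V1])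
    have "a \<in> {a. a \<lhd> x' \<in> {a. a \<lhd> y' \<in> V}}"
    proof (rule spanned_by_base_action(3)[OF V2])
      fix a x assume x: "x \<in> B"
      have V3: "cvec.subspace {a. x \<rhd> a \<in> {a. a \<lhd> x' \<in> {a. a \<lhd> y' \<in> V}}}"
        by (rule subspace_vimage[OF clinear_mult_left V2])
      have "a \<in> {a. x \<rhd> a \<in> {a. a \<lhd> x' \<in> {a. a \<lhd> y' \<in> V}}}"
        by (rule spanned_by_base_action(4)[OF V3]) (use gen x x' y' in auto)
      then show "x \<rhd> a \<in> {a. a \<lhd> x' \<in> {a. a \<lhd> y' \<in> V}}" by simp
    qed
    then show "a \<lhd> x' \<in> {a. a \<lhd> y' \<in> V}" by simp
  qed
  then show "a \<lhd> y' \<in> V" by simp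
qed

lemma subspace_K: "cvec.subspace K"
  by (simp add: ker_upC_lowC_def tensor_kernel_subspace)

lemma K_trans: "u - v \<in> K \<Longrightarrow> v - w \<in> K \<Longrightarrow> u - w \<in> K"
  using cvec.subspace_add[OF subspace_K, of "u - v" "v - w"] by simp
lemma K_sym: "u - v \<in> K \<Longrightarrow> v - u \<in> K"
  using cvec.subspace_neg[OF subspace_K, of "u - v"] by simp
lemma K_add: "u - v \<in> K \<Longrightarrow> u' - v' \<in> K \<Longrightarrow> (u + u') - (v + v') \<in> K"
  using cvec.subspace_add[OF subspace_K, of "u - v" "u' - v'"] by (simp add: algebra_simps)
lemma K_scale: "u - v \<in> K \<Longrightarrow> c *\<^sub>C u - c *\<^sub>C v \<in> K"
  using cvec.subspace_scale[OF subspace_K, of "u - v" c] by (simp add: cvec.scale_right_diff_distrib)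

lemma K_second_leg_B:
  assumes x: "x \<in> B" and u: "u \<in> K"
  shows "tensor_map id (mult_left x) u \<in> K"
  unfolding ker_upC_lowC_def
proof (rule tensor_map_tensor_kernel[OF _ _ _ u[unfolded ker_upC_lowC_def]])
  show "clinear (id :: 'a \<Rightarrow> 'a)" by (rule clinearI) auto
  fix a b a' b' :: 'a assume "((a, b), a', b') \<in> rel_C H"
  then obtain y where y: "y \<in> C" "a = t_C H y \<rhd> a'" "b' = y \<rhd> b"
    by (auto simp: rel_C_def)
  have "x \<rhd> y \<rhd> b = y \<rhd> x \<rhd> b"
    using commute[OF x y(1)] by (metis times_mult_left)
  with y show "((id a, x \<rhd> b), id a', x \<rhd> b') \<in> rel_C H"
    by (auto simp: rel_C_def)
qed (rule clinear_mult_left)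

lemma K_first_leg_C:
  assumes y: "y \<in> C" and u: "u \<in> K"
  shows "tensor_map (mult_left y) id u \<in> K"
  unfolding ker_upC_lowC_def
proof (rule tensor_map_tensor_kernel[OF _ _ _ u[unfolded ker_upC_lowC_def]])
  show "clinear (id :: 'a \<Rightarrow> 'a)" by (rule clinearI) auto
  fix a b a' b' :: 'a assume "((a, b), a', b') \<in> rel_C H"
  then obtain z where z: "z \<in> C" "a = t_C H z \<rhd> a'" "b' = z \<rhd> b"
    by (auto simp: rel_C_def)
  have "y \<rhd> t_C H z \<rhd> a' = t_C H z \<rhd> y \<rhd> a'"
    using commute[OF base_maps_in(2)[OF z(1)] y] by (metis times_mult_left)
  with z show "((y \<rhd> a, id b), y \<rhd> a', id b') \<in> rel_C H"
    by (auto simp: rel_C_def)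
qed (rule clinear_mult_left)

text \<open>
  Since \<open>B\<close> and \<open>C\<close> need not have units, the one-sided rules
  \<open>\<Delta>\<^sub>C(xa) = (1 \<otimes> x)\<Delta>\<^sub>C(a)\<close> and \<open>\<Delta>\<^sub>C(ya) = (y \<otimes> 1)\<Delta>\<^sub>C(a)\<close> are not instances of the
  four-sided bimodule axiom; they are deduced from it on the elements \<open>xyax'y'\<close>, which span. The
  maps \<open>f\<close> and \<open>g\<close> stand for \<open>id\<close> and \<open>mult_left x\<close>, or for \<open>mult_left y\<close> and \<open>id\<close>.
\<close>

lemma Delta_C_left:
  assumes T_K: "\<And>u. u \<in> K \<Longrightarrow> tensor_map f g u \<in> K"
    and gen: "\<And>x y. x \<in> B \<Longrightarrow> y \<in> C \<Longrightarrow> \<exists>x'\<in>B. \<exists>y'\<in>C. (\<forall>a. m \<rhd> x \<rhd> y \<rhd> a = x' \<rhd> y' \<rhd> a) \<and>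
      f \<circ> mult_left y = mult_left y' \<and> g \<circ> mult_left x = mult_left x'"
  shows "Delta_C H (m \<rhd> a) u - tensor_map f g (Delta_C H a u) \<in> K"
proof -
  let ?T = "tensor_map f g"
  let ?V = "{a. \<forall>u. Delta_C H (m \<rhd> a) u - ?T (Delta_C H a u) \<in> K}"
  have add: "Delta_C H (a + b) u - (Delta_C H a u + Delta_C H b u) \<in> K"
    and scale: "Delta_C H (c *\<^sub>C a) u - c *\<^sub>C Delta_C H a u \<in> K"
    and bimod: "\<And>x y x' y'. x \<in> B \<Longrightarrow> y \<in> C \<Longrightarrow> x' \<in> B \<Longrightarrow> y' \<in> C \<Longrightarrow>
      Delta_C H ((x \<rhd> y \<rhd> a) \<lhd> x' \<lhd> y') u
        - tensor_map (\<lambda>p. y \<rhd> p) (\<lambda>q. x \<rhd> q)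
            (Delta_C H a (tensor_map (\<lambda>p. y' \<rhd> p) (\<lambda>q. x' \<rhd> q) u)) \<in> K" for a b c u
    using comult_C unfolding comultiplication_C_def by blast+
  have T: "?T u - ?T v \<in> K" if "u - v \<in> K" for u v
    using T_K[OF that] by (simp add: clinear_diff[OF clinear_tensor_map])
  have "cvec.subspace ?V"
  proof (rule cvec.subspaceI)
    show scale_V: "c *\<^sub>C a \<in> ?V" if "a \<in> ?V" for c a
    proof (clarify)
      fix u
      have "Delta_C H (m \<rhd> (c *\<^sub>C a)) u - c *\<^sub>C Delta_C H (m \<rhd> a) u \<in> K"
        using scale by (simp add: clinearD(2)[OF clinear_mult_left])
      moreover have "c *\<^sub>C Delta_C H (m \<rhd> a) u - c *\<^sub>C ?T (Delta_C H a u) \<in> K"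
        using that by (intro K_scale) auto
      moreover have "c *\<^sub>C ?T (Delta_C H a u) - ?T (Delta_C H (c *\<^sub>C a) u) \<in> K"
        using K_sym[OF T[OF scale]] by (simp add: clinearD(2)[OF clinear_tensor_map])
      ultimately show "Delta_C H (m \<rhd> (c *\<^sub>C a)) u - ?T (Delta_C H (c *\<^sub>C a) u) \<in> K"
        by (blast intro: K_trans)
    qed
    show "a + b \<in> ?V" if "a \<in> ?V" "b \<in> ?V" for a b
    proof (clarify)
      fix u
      have "Delta_C H (m \<rhd> (a + b)) u - (Delta_C H (m \<rhd> a) u + Delta_C H (m \<rhd> b) u) \<in> K"
        using add by (simp add: clinearD(1)[OF clinear_mult_left])
      moreover have "(Delta_C H (m \<rhd> a) u + Delta_C H (m \<rhd> b) u)
          - (?T (Delta_C H a u) + ?T (Delta_C H b u)) \<in> K"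
        using that by (intro K_add) auto
      moreover have "(?T (Delta_C H a u) + ?T (Delta_C H b u)) - ?T (Delta_C H (a + b) u) \<in> K"
        using K_sym[OF T[OF add]] by (simp add: clinearD(1)[OF clinear_tensor_map])
      ultimately show "Delta_C H (m \<rhd> (a + b)) u - ?T (Delta_C H (a + b) u) \<in> K"
        by (blast intro: K_trans)
    qed
    show "0 \<in> ?V"
    proof (clarify)
      fix u
      have "Delta_C H 0 u \<in> K" using scale[of 0 0 u] by simp
      then show "Delta_C H (m \<rhd> 0) u - ?T (Delta_C H 0 u) \<in> K"
        by (simp add: clinear_0[OF clinear_mult_left] cvec.subspace_diff[OF subspace_K]
            T_K)
    qed
  qed
  then have "a \<in> ?V"
  proof (rule spanned_by_base_bimodule)
    fix x1 y1 x' y' a assume in_base: "x1 \<in> B" "y1 \<in> C" "x' \<in> B" "y' \<in> C"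
    let ?a = "(x1 \<rhd> y1 \<rhd> a) \<lhd> x' \<lhd> y'"
    obtain x2 y2 where 2: "x2 \<in> B" "y2 \<in> C" "m \<rhd> x1 \<rhd> y1 \<rhd> a = x2 \<rhd> y2 \<rhd> a"
      "f \<circ> mult_left y1 = mult_left y2" "g \<circ> mult_left x1 = mult_left x2"
      using gen[OF in_base(1,2)] by auto
    have ma: "m \<rhd> ?a = (x2 \<rhd> y2 \<rhd> a) \<lhd> x' \<lhd> y'"
      by (simp only: 2(3) flip: left_right_commute)
    have "Delta_C H (m \<rhd> ?a) u - ?T (Delta_C H ?a u) \<in> K" for u
    proof (rule K_trans)
      let ?w = "Delta_C H a (tensor_map (\<lambda>p. y' \<rhd> p) (\<lambda>q. x' \<rhd> q) u)"
      show "Delta_C H (m \<rhd> ?a) u - tensor_map (mult_left y2) (mult_left x2) ?w \<in> K"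
        unfolding ma by (rule bimod) (simp_all add: in_base 2)
      show "tensor_map (mult_left y2) (mult_left x2) ?w - ?T (Delta_C H ?a u) \<in> K"
        using T[OF K_sym[OF bimod[OF in_base, of a u]]] by (simp add: tensor_map_tensor_map 2)
    qed
    then show "?a \<in> ?V" by blast
  qed
  then show ?thesis by blast
qed

text \<open>
  The covered coproducts of the definitions are chosen by Hilbert's operator; they exist by the
  axioms, and non-degeneracy of the tensor product makes them unique modulo the kernel.
\<close>

lemma is_Delta_C_1_Delta_C_1: "is_Delta_C_1 H a c (Delta_C_1 H a c)"
  and is_Delta_C_2_Delta_C_2: "is_Delta_C_2 H a d (Delta_C_2 H a d)"
  using comult_C unfolding comultiplication_C_def Delta_C_1_def Delta_C_2_def
  by (metis someI_ex)+

lemma is_Delta_C_2_unique: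
  assumes "is_Delta_C_2 H a d w" and "is_Delta_C_2 H a d w'"
  shows "w - w' \<in> K"
proof -
  have "tensor_map (\<lambda>p. p * c) id (w - w') \<in> K" for c
    using K_trans[OF K_sym[OF assms(1)[unfolded is_Delta_C_2_def, rule_format]]
        assms(2)[unfolded is_Delta_C_2_def, rule_format]]
    by (simp only: clinear_diff[OF clinear_tensor_map])
  then show ?thesis using nondeg_tensors unfolding nondegenerate_tensors_def by blast
qed

lemma Delta_C_2_left:
  assumes T_K: "\<And>u. u \<in> K \<Longrightarrow> tensor_map f g u \<in> K"
    and gen: "\<And>x y. x \<in> B \<Longrightarrow> y \<in> C \<Longrightarrow> \<exists>x'\<in>B. \<exists>y'\<in>C. (\<forall>a. m \<rhd> x \<rhd> y \<rhd> a = x' \<rhd> y' \<rhd> a) \<and>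
      f \<circ> mult_left y = mult_left y' \<and> g \<circ> mult_left x = mult_left x'"
    and f: "\<And>p c. f (p * c) = f p * c"
  shows "Delta_C_2 H (m \<rhd> a) b - tensor_map f g (Delta_C_2 H a b) \<in> K"
proof (rule is_Delta_C_2_unique[OF is_Delta_C_2_Delta_C_2])
  show "is_Delta_C_2 H (m \<rhd> a) b (tensor_map f g (Delta_C_2 H a b))"
    unfolding is_Delta_C_2_def
  proof
    fix c
    let ?T = "tensor_map f g"
    have "?T (Delta_C H a (pure c b) - tensor_map (\<lambda>p. p * c) id (Delta_C_2 H a b)) \<in> K"
      using is_Delta_C_2_Delta_C_2[of a b] T_K by (auto simp: is_Delta_C_2_def)
    moreover have "f \<circ> (\<lambda>p. p * c) = (\<lambda>p. p * c) \<circ> f" by (auto simp: f)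
    ultimately have "?T (Delta_C H a (pure c b))
        - tensor_map (\<lambda>p. p * c) id (?T (Delta_C_2 H a b)) \<in> K"
      by (simp add: clinear_diff[OF clinear_tensor_map] tensor_map_tensor_map)
    with Delta_C_left[OF T_K gen]
    show "Delta_C H (m \<rhd> a) (pure c b) - tensor_map (\<lambda>p. p * c) id (?T (Delta_C_2 H a b)) \<in> K"
      by (rule K_trans)
  qed
qed

lemma Delta_C_2_left_B:
  assumes x: "x \<in> B"
  shows "Delta_C_2 H (x \<rhd> a) b - tensor_map id (mult_left x) (Delta_C_2 H a b) \<in> K"
proof (rule Delta_C_2_left[OF K_second_leg_B[OF x]])
  fix x1 y1 assume "x1 \<in> B" "y1 \<in> C"
  then show "\<exists>x'\<in>B. \<exists>y'\<in>C. (\<forall>a. x \<rhd> x1 \<rhd> y1 \<rhd> a = x' \<rhd> y' \<rhd> a) \<and>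
      id \<circ> mult_left y1 = mult_left y' \<and> mult_left x \<circ> mult_left x1 = mult_left x'"
    by (intro bexI[of _ "x * x1"] bexI[of _ y1]) (auto simp: times_mult_left mult_B x)
qed simp_all

lemma Delta_C_2_left_C:
  assumes y: "y \<in> C"
  shows "Delta_C_2 H (y \<rhd> a) b - tensor_map (mult_left y) id (Delta_C_2 H a b) \<in> K"
proof (rule Delta_C_2_left[OF K_first_leg_C[OF y]])
  fix x1 y1 assume 1: "x1 \<in> B" "y1 \<in> C"
  have "y \<rhd> x1 \<rhd> y1 \<rhd> a = x1 \<rhd> (y * y1) \<rhd> a" for a
    using commute[OF 1(1) y] by (metis times_mult_left)
  with 1 show "\<exists>x'\<in>B. \<exists>y'\<in>C. (\<forall>a. y \<rhd> x1 \<rhd> y1 \<rhd> a = x' \<rhd> y' \<rhd> a) \<and>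
      mult_left y \<circ> mult_left y1 = mult_left y' \<and> id \<circ> mult_left x1 = mult_left x'"
    by (intro bexI[of _ x1] bexI[of _ "y * y1"]) (auto simp: times_mult_left mult_C y)
qed (simp_all add: mult_left_mult)

section \<open>Module properties of the counits\<close>

lemma eps_range: "eps_C H a \<in> C" "eps_B H a \<in> B"
  and clinear_eps_C: "clinear (eps_C H)"
  using counits by (auto simp: counits_and_antipode_def)

lemma eps_C_sends: "sends K (\<lambda>(p, q). eps_C H p \<rhd> q) (Delta_C_2 H a b) (a * b)"
  and t_C_eps_C_sends: "sends K (\<lambda>(p, q). t_C H (eps_C H q) \<rhd> p) (Delta_C_1 H b a) (b * a)"
  and antipode_sends: "sends K (\<lambda>(p, q). S p * q) (Delta_C_2 H a b) (eps_B H a \<rhd> b)"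
  using counits by (simp_all add: counits_and_antipode_def)

lemma rel_C_I: "y \<in> C \<Longrightarrow> ((t_C H y \<rhd> a, b), (a, y \<rhd> b)) \<in> rel_C H"
  by (auto simp: rel_C_def)

text \<open>
  Balancedness of \<open>p \<otimes> q \<mapsto> t\<^sub>C(\<^sub>C\<epsilon>(q))p\<close> over \<open>C\<close> gives
  \<open>t\<^sub>C(\<^sub>C\<epsilon>(a))t\<^sub>C(y) = t\<^sub>C(\<^sub>C\<epsilon>(ya))\<close>, and \<open>t\<^sub>C\<close> is an injective anti-homomorphism. The next rule
  follows in the same way from \<open>p \<otimes> q \<mapsto> \<^sub>C\<epsilon>(p)q\<close>.
\<close>

lemma eps_C_left:
  assumes y: "y \<in> C"
  shows "eps_C H (y \<rhd> a) = y * eps_C H a"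
proof -
  have "t_C H (y * eps_C H a) = t_C H (eps_C H (y \<rhd> a))"
  proof (rule multiplier_eqI_left[OF nondeg])
    fix p
    show "t_C H (y * eps_C H a) \<rhd> p = t_C H (eps_C H (y \<rhd> a)) \<rhd> p"
      using sends_balanced[OF t_C_eps_C_sends[unfolded ker_upC_lowC_def] rel_C_I[OF y, of p a]]
      by (simp add: base_maps_mult y eps_range times_mult_left)
  qed
  then have "S_B H (t_C H (y * eps_C H a)) = S_B H (t_C H (eps_C H (y \<rhd> a)))" by simp
  then show ?thesis by (simp add: base_maps_inverse mult_C y eps_range)
qed

lemma eps_C_t_C:
  assumes y: "y \<in> C"
  shows "eps_C H (t_C H y \<rhd> a) = eps_C H a * y"
proof (rule multiplier_eqI_left[OF nondeg])
  fix q
  show "eps_C H (t_C H y \<rhd> a) \<rhd> q = (eps_C H a * y) \<rhd> q"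
    using sends_balanced[OF eps_C_sends[unfolded ker_upC_lowC_def] rel_C_I[OF y, of a q]]
    by (simp add: times_mult_left)
qed

text \<open>
  Writing \<open>\<Delta>\<^sub>C(a)(1 \<otimes> b)\<close> as a sum of \<open>p \<otimes> q\<close>, both sides act on \<open>b\<close> as the sum of the
  \<open>S(p)xq = S(t\<^sub>B(x)p)q\<close>.
\<close>

lemma eps_B_left_t_B:
  assumes x: "x \<in> B"
  shows "eps_B H (x \<rhd> a) = eps_B H (t_B H x \<rhd> a)"
proof (rule multiplier_eqI_left[OF nondeg])
  fix b
  show "eps_B H (x \<rhd> a) \<rhd> b = eps_B H (t_B H x \<rhd> a) \<rhd> b"
  proof -
    let ?h = "lin_ext (\<lambda>(p, q). S p * q)" and ?w = "Delta_C_2 H a b"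
    have K: "?h u = 0" if "u \<in> K" for u
      using sends_kernel[OF antipode_sends subspace_K that] .
    have "eps_B H (x \<rhd> a) \<rhd> b = ?h (Delta_C_2 H (x \<rhd> a) b)"
      "eps_B H (t_B H x \<rhd> a) \<rhd> b = ?h (Delta_C_2 H (t_B H x \<rhd> a) b)"
      by (simp_all add: sends_value[OF antipode_sends subspace_K])
    moreover have "?h (Delta_C_2 H (x \<rhd> a) b) = ?h (tensor_map id (mult_left x) ?w)"
      using K[OF Delta_C_2_left_B[OF x]] by (simp add: lin_ext_diff)
    moreover have "?h (Delta_C_2 H (t_B H x \<rhd> a) b) = ?h (tensor_map (mult_left (t_B H x)) id ?w)"
      using K[OF Delta_C_2_left_C[OF base_maps_in(1)[OF x]]] by (simp add: lin_ext_diff)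
    moreover have "?h (tensor_map id (mult_left x) ?w) = ?h (tensor_map (mult_left (t_B H x)) id ?w)"
      unfolding lin_ext_tensor_map
      by (intro lin_ext_cong)
        (auto simp: antipode_actions base_maps_in base_maps_inverse x mult_mult_left)
    ultimately show ?thesis by simp
  qed
qed

text \<open>
  The range of \<open>\<^sub>C\<epsilon>\<close> is a right ideal \<open>I\<close> of \<open>C\<close> with \<open>IA = A\<close> by the counit property, so it
  contains \<open>f(IA) = If(A)\<close>, which is the range of \<open>f\<close>, for every left \<open>C\<close>-linear \<open>f : A \<rightarrow> C\<close>.
\<close>

lemma range_eps_C:
  assumes f: "clinear f" "\<And>y a. y \<in> C \<Longrightarrow> f (y \<rhd> a) = y * f a" "range f = C"
  shows "range (eps_C H) = C"
proof
  let ?I = "range (eps_C H)"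
  show "?I \<subseteq> C" using eps_range by auto
  have sub: "cvec.subspace ?I"
    by (rule module_hom.subspace_image[OF clinear_module_hom[OF clinear_eps_C] cvec.subspace_UNIV])
  have fC: "f a \<in> C" for a using f(3) by auto
  have "f a \<in> ?I" for a
  proof -
    have "a \<in> {a. f a \<in> ?I}"
    proof (rule subspace_of_span_UNIV[OF span_products subspace_vimage[OF f(1) sub]])
      fix c :: 'a assume "c \<in> {a * b | a b. True}"
      then obtain a b where "c = a * b" by blast
      then have "f c = f (lin_ext (\<lambda>(p, q). eps_C H p \<rhd> q) (Delta_C_2 H a b))"
        by (simp add: sends_value[OF eps_C_sends subspace_K])
      also have "\<dots> = lin_ext (\<lambda>(p, q). eps_C H (t_C H (f q) \<rhd> p)) (Delta_C_2 H a b)"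
        unfolding clinear_compose_lin_ext[OF f(1)]
        by (intro lin_ext_cong) (auto simp: f(2) eps_range eps_C_t_C[OF fC])
      also have "\<dots> \<in> cvec.span ?I"
        by (rule subsetD[OF cvec.span_mono lin_ext_in_span]) auto
      finally show "c \<in> {a. f a \<in> ?I}" using sub by (simp add: cvec.span_eq_iff[THEN iffD2])
    qed
    then show ?thesis by simp
  qed
  with f(3) show "C \<subseteq> ?I" by (metis image_subsetI)
qed

end

section \<open>Measured regular multiplier Hopf algebroids\<close>

locale measured_hopf_algebroid =
  fixes M :: "'a::complex_algebra measured_hopf_algebroid"
  assumes measured: "measured_regular_multiplier_hopf_algebroid M"
begin

sublocale regular_hopf_algebroid M
  using measured by unfold_locales (simp add: measured_regular_multiplier_hopf_algebroid_def)

lemma faithful_mu_B: "faithful_functional B (mu_B M)"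
  and faithful_mu_C: "faithful_functional C (mu_C M)"
  and mu_C_eq: "y \<in> C \<Longrightarrow> mu_C M y = mu_B M (S_C M y)"
  and mu_B_eq: "x \<in> B \<Longrightarrow> mu_B M x = mu_C M (S_B M x)"
  and mu_eps: "mu_B M (eps_B M a) = mu_C M (eps_C M a)"
  and clinear_Phi: "clinear (Phi M)" and Phi_range: "Phi M a \<in> C"
  and Phi_bimodule: "y \<in> C \<Longrightarrow> y' \<in> C \<Longrightarrow> Phi M (y \<rhd> a \<lhd> y') = y * Phi M a * y'"
  and faithful_phi: "faithful_functional UNIV (phi M)"
  using measured unfolding measured_regular_multiplier_hopf_algebroid_def by blast+

text \<open>
  The modular rule for \<open>\<mu>\<^sub>C\<close> comes from evaluating \<open>\<mu>\<^sub>B \<circ> \<epsilon>\<^sub>B = \<mu>\<^sub>C \<circ> \<^sub>C\<epsilon>\<close> on \<open>xa\<close> and on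
  \<open>t\<^sub>B(x)a\<close>, which \<open>\<epsilon>\<^sub>B\<close> does not distinguish.
\<close>

lemma mu_C_modular:
  assumes x: "x \<in> B" and z: "z \<in> C"
  shows "mu_C M (z * S_B M x) = mu_C M (t_B M x * z)"
proof -
  obtain f where f: "is_left_factor C (mu_C M) (psi M) f" "range f = C"
    using measured unfolding measured_regular_multiplier_hopf_algebroid_def by blast
  have "range (eps_C M) = C"
    by (rule range_eps_C[of f]) (use f in \<open>auto simp: is_left_factor_def\<close>)
  with z obtain a where a: "z = eps_C M a" by auto
  have "mu_C M (z * S_B M x) = mu_C M (eps_C M (x \<rhd> a))"
    using eps_C_t_C[OF base_maps_in(3)[OF x], of a] by (simp add: a base_maps_inverse x)
  also have "\<dots> = mu_C M (eps_C M (t_B M x \<rhd> a))"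
    by (simp add: eps_B_left_t_B[OF x] flip: mu_eps)
  finally show ?thesis by (simp add: a eps_C_left base_maps_in x)
qed

lemma mu_B_modular:
  assumes x: "x \<in> B" "x1 \<in> B"
  shows "mu_B M (x1 * x) = mu_B M (S_ext M (S_ext M x) * x1)"
proof -
  have "mu_B M (x1 * x) = mu_C M (S_B M x * S_B M x1)"
    by (simp add: mu_B_eq mult_B base_maps_mult x)
  also have "\<dots> = mu_C M (t_B M x1 * S_B M x)"
    by (rule mu_C_modular) (simp_all add: base_maps_in x)
  also have "\<dots> = mu_B M (S_C M (S_B M x) * x1)"
    by (simp add: mu_C_eq mult_C base_maps_in base_maps_mult base_maps_inverse x)
  finally show ?thesis by (simp add: S_ext_B S_ext_C base_maps_in x)
qed

text \<open>
  \<open>C\<close> need not have a unit, so the right factor in the bimodule property of \<open>\<Phi>\<close> is removed by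
  writing \<open>a\<close> as a combination of elements \<open>za'y'\<close>.
\<close>

lemma Phi_left:
  assumes y: "y \<in> C"
  shows "Phi M (y \<rhd> a) = y * Phi M a"
proof -
  have lin: "clinear (\<lambda>a. Phi M (y \<rhd> a))" "clinear (\<lambda>a. y * Phi M a)"
    by (rule clinear_comp[OF clinear_Phi clinear_mult_left],
        rule clinear_comp[OF clinear_times_left clinear_Phi])
  have "clinear (\<lambda>a. Phi M (y \<rhd> a) - y * Phi M a)"
    by (rule clinearI) (simp_all add: clinearD[OF lin(1)] clinearD[OF lin(2)]
        cvec.scale_right_diff_distrib)
  note V = subspace_vimage[OF this, of "{0}"]
  have "a \<in> {a. Phi M (y \<rhd> a) - y * Phi M a \<in> {0}}"
  proof (rule spanned_by_base_action(2)[OF V])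
    fix a y' assume y': "y' \<in> C"
    have V': "cvec.subspace {a. a \<lhd> y' \<in> {a. Phi M (y \<rhd> a) - y * Phi M a \<in> {0}}}"
      by (intro subspace_vimage[OF clinear_mult_right] V) simp
    have "a \<in> {a. a \<lhd> y' \<in> {a. Phi M (y \<rhd> a) - y * Phi M a \<in> {0}}}"
    proof (rule spanned_by_base_action(4)[OF V'])
      fix a z assume z: "z \<in> C"
      have "y \<rhd> (z \<rhd> a \<lhd> y') = (y * z) \<rhd> a \<lhd> y'"
        by (simp add: times_mult_left left_right_commute)
      then show "z \<rhd> a \<in> {a. a \<lhd> y' \<in> {a. Phi M (y \<rhd> a) - y * Phi M a \<in> {0}}}"
        by (simp add: Phi_bimodule y' z mult_C y mult.assoc)
    qed
    then show "a \<lhd> y' \<in> {a. Phi M (y \<rhd> a) - y * Phi M a \<in> {0}}" by simp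
  qed simp
  then show ?thesis by simp
qed

text \<open>This is \<open>\<^sub>B\<Phi>\<close>, which faithfulness of \<open>\<mu>\<^sub>B\<close> determines uniquely.\<close>

definition left_Phi :: "'a \<Rightarrow> 'a multiplier" where
  "left_Phi = (SOME f. is_left_factor B (mu_B M) (phi M) f \<and> range f = B)"

lemma left_Phi: "is_left_factor B (mu_B M) (phi M) left_Phi" and range_left_Phi: "range left_Phi = B"
proof -
  have "\<exists>f. is_left_factor B (mu_B M) (phi M) f \<and> range f = B"
    using measured unfolding measured_regular_multiplier_hopf_algebroid_def by blast
  from someI_ex[OF this] show "is_left_factor B (mu_B M) (phi M) left_Phi" "range left_Phi = B"
    by (simp_all add: left_Phi_def)
qed

lemma clinear_left_Phi: "clinear left_Phi"
  using left_Phi by (simp add: is_left_factor_def)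

lemma left_Phi_in: "left_Phi a \<in> B"
  using range_left_Phi by auto

lemma left_factor_phi_B: "is_left_factor B (mu_B M) (\<lambda>a. phi M (a * c)) (\<lambda>a. left_Phi (a * c))"
  using left_Phi clinear_comp[OF clinear_left_Phi clinear_times_right]
  by (auto simp: is_left_factor_def simp flip: mult_left_mult)

lemma left_factor_phi_C: "is_left_factor C (mu_C M) (\<lambda>a. phi M (a * c)) (\<lambda>a. Phi M (a * c))"
  using clinear_comp[OF clinear_Phi clinear_times_right]
  by (auto simp: is_left_factor_def phi_def Phi_range Phi_left simp flip: mult_left_mult)

lemma clinear_phi: "clinear (phi M)"
  using faithful_phi by (auto simp: faithful_functional_def linear_on_def intro!: clinearI)

lemma phi_separates: "(\<And>c. phi M (a * c) = 0) \<Longrightarrow> a = 0"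
  using faithful_phi by (auto simp: faithful_functional_def)

text \<open>The functionals \<open>\<phi>(\<cdot> c)\<close> depend linearly on \<open>c\<close>, so they form a subspace already.\<close>

lemma dual_space_eq: "dual_space M = range (\<lambda>c a. phi M (a * c))"
proof -
  have "clinear (\<lambda>c a. phi M (a * c))"
    by (rule clinearI)
      (auto simp: fun_eq_iff algebra_simps scaleC_fun_def scaleC_mult_right clinearD[OF clinear_phi])
  from module_hom.subspace_image[OF clinear_module_hom[OF this] cvec.subspace_UNIV]
  have "cvec.span (range (\<lambda>c a. phi M (a * c))) = range (\<lambda>c a. phi M (a * c))"
    by (rule cvec.span_eq_iff[THEN iffD2])
  moreover have "{(\<lambda>a. phi M (a * c)) | c. True} = range (\<lambda>c a. phi M (a * c))" by auto
  ultimately show ?thesis by (simp add: dual_space_def)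
qed

text \<open>
  The map \<open>p \<otimes> q \<mapsto> S(\<^sub>B\<Phi>(p))q\<close> is well defined because
  \<open>S(\<^sub>B\<Phi>(t\<^sub>C(y)p)) = S(t\<^sub>C(y) \<^sub>B\<Phi>(p)) = S(\<^sub>B\<Phi>(p))y\<close>.
\<close>

lemma slice_map_balanced:
  assumes u: "u \<in> K"
  shows "lin_ext (\<lambda>(p, q). S_B M (left_Phi p) \<rhd> q) u = 0"
proof (rule lin_ext_tensor_kernel_zero[OF _ _ u[unfolded ker_upC_lowC_def]])
  have lin: "clinear (\<lambda>p. S_B M (left_Phi p))"
    by (rule clinear_linear_on_comp[OF clinear_left_Phi])
      (use range_left_Phi anti_S_B in \<open>auto simp: anti_isomorphism_def\<close>)
  show "cbilinear (\<lambda>p q. S_B M (left_Phi p) \<rhd> q)"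
    by (rule cbilinearI[OF clinear_mult_left clinear_comp[OF clinear_multiplier_left lin]])
  fix a b a' b' :: 'a assume "((a, b), a', b') \<in> rel_C M"
  then obtain y where y: "y \<in> C" "a = t_C M y \<rhd> a'" "b' = y \<rhd> b"
    by (auto simp: rel_C_def)
  have "left_Phi a = t_C M y * left_Phi a'"
    using left_Phi y by (simp add: is_left_factor_def base_maps_in)
  then show "S_B M (left_Phi a) \<rhd> b = S_B M (left_Phi a') \<rhd> b'"
    by (simp add: base_maps_mult base_maps_in base_maps_inverse y left_Phi_in times_mult_left)
qed

text \<open>
  With \<open>\<Delta>\<^sub>C(a)(c \<otimes> 1)\<close> the sum of \<open>p \<otimes> q\<close>, this is the sum of the \<open>S(\<^sub>B\<Phi>(p))q\<close>: the right
  action on \<open>a\<close> of the functional \<open>\<phi>(\<cdot> c)\<close>.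
\<close>

definition slice :: "'a \<Rightarrow> 'a \<Rightarrow> 'a" where
  "slice a c = lin_ext (\<lambda>(p, q). S_B M (left_Phi p) \<rhd> q) (Delta_C_1 M a c)"

text \<open>
  The canonical map \<open>\<T>\<^sub>4\<close> is onto, so the span of the slices contains all \<open>S(\<^sub>B\<Phi>(p))q\<close>; these
  span \<open>CA = A\<close> because \<open>\<^sub>B\<Phi>\<close> is onto \<open>B\<close>.
\<close>

lemma slices_span:
  assumes V: "cvec.subspace V" and slice: "\<And>a c. slice a c \<in> V"
  shows "a \<in> V"
proof (rule spanned_by_base_action(4)[OF V])
  fix q y assume "y \<in> C"
  then have "t_C M y \<in> range left_Phi" and y: "S_B M (t_C M y) = y"
    by (simp_all add: range_left_Phi base_maps_in base_maps_inverse)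
  then obtain p where p: "t_C M y = left_Phi p" by auto
  let ?G = "\<lambda>(p, q). S_B M (left_Phi p) \<rhd> q"
  obtain u where u: "canonical_T4 M u - pure p q \<in> K"
    using canonical unfolding canonical_maps_bijective_def bijective_mod_def by blast
  have "y \<rhd> q = lin_ext ?G (canonical_T4 M u)"
    using slice_map_balanced[OF u] y by (simp add: lin_ext_diff p)
  also have "\<dots> = lin_ext (\<lambda>(c, a). slice a c) u"
    unfolding canonical_T4_def clinear_compose_lin_ext[OF clinear_lin_ext]
    by (intro lin_ext_cong) (auto simp: slice_def)
  also have "\<dots> \<in> cvec.span (range (\<lambda>(c, a). slice a c))"
    by (rule lin_ext_in_span)
  also have "\<dots> \<subseteq> V"
    by (rule cvec.span_minimal[OF _ V]) (auto simp: slice)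
  finally show "y \<rhd> q \<in> V" .
qed

end

section \<open>The dual\<close>

locale dual_hopf_algebroid = measured_hopf_algebroid M
  for M :: "'a::complex_algebra measured_hopf_algebroid" +
  fixes A' :: "'d::complex_algebra hopf_algebroid" and ev :: "'d \<Rightarrow> 'a \<Rightarrow> complex"
  assumes dual: "is_dual M A' ev"
begin

lemmas dual_conditions = dual[unfolded is_dual_def]
lemmas regular_dual = dual_conditions[THEN conjunct1]
lemmas clinear_ev = dual_conditions[THEN conjunct2, THEN conjunct1]
lemmas bij_ev = dual_conditions[THEN conjunct2, THEN conjunct2, THEN conjunct1]
lemmas dual_product = dual_conditions[THEN conjunct2, THEN conjunct2, THEN conjunct2,
  THEN conjunct1, rule_format]
lemmas dual_rest = dual_conditions[THEN conjunct2, THEN conjunct2, THEN conjunct2,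
  THEN conjunct2]
lemmas dual_bases = dual_rest[THEN conjunct1]
lemmas ev_antipode = dual_rest[THEN conjunct2, THEN conjunct1, rule_format]
lemmas transposes_T1 = dual_rest[THEN conjunct2, THEN conjunct2, THEN conjunct1]
lemmas transposes_T2 = dual_rest[THEN conjunct2, THEN conjunct2, THEN conjunct2]

sublocale dual: regular_hopf_algebroid A'
  by unfold_locales (rule regular_dual)

abbreviation "S' \<equiv> antipode A'"

lemma ev_inj: "ev \<upsilon> = ev \<omega> \<Longrightarrow> \<upsilon> = \<omega>"
  using bij_ev by (auto simp: bij_betw_def dest: injD)

lemma ev_add: "ev (\<upsilon> + \<omega>) a = ev \<upsilon> a + ev \<omega> a" and ev_scale: "ev (c *\<^sub>C \<omega>) a = c *\<^sub>C ev \<omega> a"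
  by (simp_all add: clinearD[OF clinear_ev] scaleC_fun_def)

definition dual_elem :: "'a \<Rightarrow> 'd" where
  "dual_elem c = inv_into UNIV ev (\<lambda>a. phi M (a * c))"

lemma ev_dual_elem [simp]: "ev (dual_elem c) a = phi M (a * c)"
proof -
  have "(\<lambda>a. phi M (a * c)) \<in> dual_space M" by (simp add: dual_space_eq)
  then have "ev (dual_elem c) = (\<lambda>a. phi M (a * c))"
    unfolding dual_elem_def by (rule bij_betw_inv_into_right[OF bij_ev])
  then show ?thesis by simp
qed

lemma dual_elem_eq: "ev (dual_elem c) = (\<lambda>a. phi M (a * c))"
  by auto

lemma dual_elem_cases: obtains c where "\<omega> = dual_elem c"
proof -
  have "ev \<omega> \<in> dual_space M" using bij_ev by (auto simp: bij_betw_def)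
  then obtain c where "ev \<omega> = (\<lambda>a. phi M (a * c))" by (auto simp: dual_space_eq)
  then have "\<omega> = dual_elem c" by (intro ev_inj) auto
  then show ?thesis by (rule that)
qed

lemma clinear_dual_elem: "clinear dual_elem"
  by (rule clinearI; rule ev_inj)
    (auto simp: ev_add ev_scale algebra_simps scaleC_mult_right clinearD[OF clinear_phi])

lemma clinear_ev_left: "clinear (ev \<omega>)"
proof -
  obtain c where "\<omega> = dual_elem c" by (rule dual_elem_cases)
  then show ?thesis using clinear_comp[OF clinear_phi clinear_times_right[of c]]
    by (simp add: dual_elem_eq)
qed

lemma ev_separates: "(\<And>\<omega>. ev \<omega> a = 0) \<Longrightarrow> a = 0"
  by (rule phi_separates) (metis ev_dual_elem)

lemma ev_eqI: "(\<And>\<omega>. ev \<omega> a = ev \<omega> b) \<Longrightarrow> a = b"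
  using ev_separates[of "a - b"] by (simp add: clinear_diff[OF clinear_ev_left])

lemma left_factors:
  shows "is_left_factor B (mu_B M) (ev \<omega>) (fac_lB M (ev \<omega>))"
    and "is_left_factor C (mu_C M) (ev \<omega>) (fac_lC M (ev \<omega>))"
proof -
  obtain c where c: "\<omega> = dual_elem c" by (rule dual_elem_cases)
  show "is_left_factor B (mu_B M) (ev \<omega>) (fac_lB M (ev \<omega>))"
    unfolding fac_lB_def c dual_elem_eq
    by (rule the_left_factor[OF faithful_mu_B subalgebra_B left_factor_phi_B])
  show "is_left_factor C (mu_C M) (ev \<omega>) (fac_lC M (ev \<omega>))"
    unfolding fac_lC_def c dual_elem_eq
    by (rule the_left_factor[OF faithful_mu_C subalgebra_C left_factor_phi_C])
qed

lemma fac_lB_dual_elem: "fac_lB M (ev (dual_elem c)) p = left_Phi (p * c)"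
  using left_factor_unique[OF faithful_mu_B subalgebra_B left_factors(1) left_factor_phi_B[of c,
        folded dual_elem_eq]] by simp

text \<open>
  Right factors exist because every element of the dual is \<open>\<omega> \<circ> S\<close> for some \<open>\<omega>\<close> of the dual, and
  \<open>S\<close> turns left factors over \<open>C\<close> and \<open>B\<close> into right factors over \<open>B\<close> and \<open>C\<close>.
\<close>

lemma right_factors:
  shows "is_right_factor B (mu_B M) (ev \<omega>) (fac_rB M (ev \<omega>))"
    and "is_right_factor C (mu_C M) (ev \<omega>) (fac_rC M (ev \<omega>))"
proof -
  obtain \<omega>' where "\<omega> = S' \<omega>'" using dual.bij_antipode by (auto simp: bij_def surj_def)
  then have ev: "ev \<omega> = (\<lambda>a. ev \<omega>' (S a))" by (auto simp: ev_antipode)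
  define f where "f = fac_lC M (ev \<omega>')"
  define g where "g = fac_lB M (ev \<omega>')"
  have f: "clinear f" "f a \<in> C" "y \<in> C \<Longrightarrow> f (y \<rhd> a) = y * f a" "ev \<omega>' a = mu_C M (f a)"
    and g: "clinear g" "g a \<in> B" "x \<in> B \<Longrightarrow> g (x \<rhd> a) = x * g a" "ev \<omega>' a = mu_B M (g a)" for a x y
    using left_factors[of \<omega>'] by (auto simp: is_left_factor_def f_def g_def)
  have 1: "is_right_factor B (mu_B M) (ev \<omega>) (\<lambda>a. t_C M (f (S a)))"
    unfolding is_right_factor_def
  proof (intro conjI ballI allI)
    show "clinear (\<lambda>a. t_C M (f (S a)))"
      by (rule clinear_linear_on_comp[OF clinear_comp[OF f(1) clinear_antipode], of C])
        (use anti_t_C f(2) in \<open>auto simp: anti_isomorphism_def\<close>)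
    show "range (\<lambda>a. t_C M (f (S a))) \<subseteq> B" using f(2) base_maps_in by auto
    show "t_C M (f (S (a \<lhd> x))) = t_C M (f (S a)) * x" if "x \<in> B" for x a
      using that by (simp add: antipode_actions f(2,3) base_maps_in base_maps_mult base_maps_inverse)
    show "ev \<omega> a = mu_B M (t_C M (f (S a)))" for a
      by (simp add: ev f(2,4) mu_B_eq base_maps_in base_maps_inverse)
  qed
  have 2: "is_right_factor C (mu_C M) (ev \<omega>) (\<lambda>a. t_B M (g (S a)))"
    unfolding is_right_factor_def
  proof (intro conjI ballI allI)
    show "clinear (\<lambda>a. t_B M (g (S a)))"
      by (rule clinear_linear_on_comp[OF clinear_comp[OF g(1) clinear_antipode], of B])
        (use anti_t_B g(2) in \<open>auto simp: anti_isomorphism_def\<close>)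
    show "range (\<lambda>a. t_B M (g (S a))) \<subseteq> C" using g(2) base_maps_in by auto
    show "t_B M (g (S (a \<lhd> y))) = t_B M (g (S a)) * y" if "y \<in> C" for y a
      using that by (simp add: antipode_actions g(2,3) base_maps_in base_maps_mult base_maps_inverse)
    show "ev \<omega> a = mu_C M (t_B M (g (S a)))" for a
      by (simp add: ev g(2,4) mu_C_eq base_maps_in base_maps_inverse)
  qed
  show "is_right_factor B (mu_B M) (ev \<omega>) (fac_rB M (ev \<omega>))"
    unfolding fac_rB_def
    by (rule the_right_factor[OF faithful_mu_B subalgebra_B 1])
  show "is_right_factor C (mu_C M) (ev \<omega>) (fac_rC M (ev \<omega>))"
    unfolding fac_rC_def
    by (rule the_right_factor[OF faithful_mu_C subalgebra_C 2])
qed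

section \<open>The evaluation pairing is admissible\<close>

text \<open>
  The product formula for the dual is stated for a second factor \<open>b \<triangleright> \<omega>\<close>, with the coproduct
  covered by \<open>b\<close> on the right leg. For \<open>\<upsilon> = \<phi>(\<cdot> c)\<close> the coproduct is covered on the left leg by
  \<open>c\<close> as well, so \<open>b\<close> can be moved back from the coproduct into \<open>\<omega>\<close>.
\<close>

lemma product_slice_covered:
  assumes b\<omega>: "ev b\<omega> = (\<lambda>a. ev \<omega> (a * b))"
  shows "ev (dual_elem c * b\<omega>) a = ev b\<omega> (slice a c)"
proof -
  let ?G = "\<lambda>(p, q). S_B M (left_Phi p) \<rhd> q"
  let ?f = "\<lambda>(p, q). mu_C M (S_ext M (fac_lB M (ev (dual_elem c)) p) * fac_lC M (ev \<omega>) q)"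
  have f: "?f (p, q) = ev \<omega> (?G (p * c, q))" for p q
    using left_factors(2)[of \<omega>]
    by (simp add: fac_lB_dual_elem S_ext_B left_Phi_in is_left_factor_def base_maps_in)
  have "ev (dual_elem c * b\<omega>) a = lin_ext ?f (Delta_C_2 M a b)"
    by (rule sends_value[OF dual_product[OF b\<omega>] subspace_K, symmetric])
  also have "\<dots> = lin_ext (\<lambda>k. ev \<omega> (case k of (p, q) \<Rightarrow> ?G (p * c, id q))) (Delta_C_2 M a b)"
    using f by (intro lin_ext_cong) auto
  also have "\<dots> = ev \<omega> (lin_ext ?G (tensor_map (\<lambda>p. p * c) id (Delta_C_2 M a b)))"
    by (simp only: lin_ext_tensor_map clinear_compose_lin_ext[OF clinear_ev_left])
  also have "lin_ext ?G (tensor_map (\<lambda>p. p * c) id (Delta_C_2 M a b))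
      = lin_ext ?G (tensor_map id (\<lambda>q. q * b) (Delta_C_1 M a c))"
  proof -
    have "tensor_map (\<lambda>p. p * c) id (Delta_C_2 M a b)
        - tensor_map id (\<lambda>q. q * b) (Delta_C_1 M a c) \<in> K"
      using is_Delta_C_2_Delta_C_2[of a b] is_Delta_C_1_Delta_C_1[of a c]
      unfolding is_Delta_C_1_def is_Delta_C_2_def by (blast intro: K_trans K_sym)
    from slice_map_balanced[OF this] show ?thesis by (simp add: lin_ext_diff)
  qed
  also have "\<dots> = slice a c * b"
    unfolding lin_ext_tensor_map slice_def clinear_compose_lin_ext[OF clinear_times_right]
    by (intro lin_ext_cong) (auto simp: mult_left_mult)
  finally show ?thesis by (simp add: b\<omega>)
qed

text \<open>
  Functionals of the form \<open>b \<triangleright> \<omega>\<close> exhaust the dual up to linear combinations, since \<open>A\<close> is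
  idempotent and \<open>b \<triangleright> \<phi>(\<cdot> e) = \<phi>(\<cdot> be)\<close>.
\<close>

lemma product_slice: "ev (dual_elem c * \<omega>) a = ev \<omega> (slice a c)"
proof -
  have lin: "clinear (\<lambda>d. ev (dual_elem c * dual_elem d) a)"
    "clinear (\<lambda>d. ev (dual_elem d) (slice a c))"
    by (rule clinearI; simp add: clinearD[OF clinear_dual_elem] ev_add ev_scale distrib_left
        scaleC_mult_right del: ev_dual_elem)+
  obtain d where d: "\<omega> = dual_elem d" by (rule dual_elem_cases)
  show ?thesis
    unfolding d
  proof (rule clinear_eq_on_span[OF lin])
    show "d \<in> cvec.span {a * b | a b :: 'a. True}" unfolding span_products by (rule UNIV_I)
    fix e :: 'a assume "e \<in> {a * b | a b. True}"
    then obtain b e' where e: "e = b * e'" by blast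
    have "ev (dual_elem e) = (\<lambda>a. ev (dual_elem e') (a * b))"
      by (auto simp: e mult.assoc)
    then show "ev (dual_elem c * dual_elem e) a = ev (dual_elem e) (slice a c)"
      by (rule product_slice_covered)
  qed
qed

definition act_right :: "'a \<Rightarrow> 'd \<Rightarrow> 'a" where
  "act_right a \<upsilon> = (SOME z. \<forall>\<omega>. ev (\<upsilon> * \<omega>) a = ev \<omega> z)"

lemma ev_act_right: "ev \<omega> (act_right a \<upsilon>) = ev (\<upsilon> * \<omega>) a"
proof -
  obtain c where "\<upsilon> = dual_elem c" by (rule dual_elem_cases)
  then have "\<forall>\<omega>. ev (\<upsilon> * \<omega>) a = ev \<omega> (slice a c)" by (simp add: product_slice)
  then have "\<forall>\<omega>. ev (\<upsilon> * \<omega>) a = ev \<omega> (act_right a \<upsilon>)"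
    unfolding act_right_def by (rule someI)
  then show ?thesis by simp
qed

lemma act_right_dual_elem: "act_right a (dual_elem c) = slice a c"
  by (rule ev_eqI) (simp only: ev_act_right product_slice)

lemma span_act_right:
  assumes "cvec.subspace V" and "\<And>a \<upsilon>. act_right a \<upsilon> \<in> V"
  shows "a \<in> V"
  by (rule slices_span[OF assms(1)]) (metis act_right_dual_elem assms(2))

text \<open>
  The antipodes are anti-multiplicative and adjoint to each other, so they turn a right action that
  is adjoint to left multiplication into a left action that is adjoint to right multiplication.
\<close>

definition act_left :: "'d \<Rightarrow> 'a \<Rightarrow> 'a" where
  "act_left \<upsilon> a = inv S (act_right (S a) (inv S' \<upsilon>))"

lemma S_inv: "S (inv S a) = a" "inv S (S a) = a" and S'_inv: "S' (inv S' \<omega>) = \<omega>" "inv S' (S' \<omega>) = \<omega>"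
  using bij_antipode dual.bij_antipode by (simp_all add: bij_is_surj bij_is_inj surj_f_inv_f)

lemma ev_act_left: "ev \<omega> (act_left \<upsilon> a) = ev (\<omega> * \<upsilon>) a"
proof -
  have "ev \<omega> (act_left \<upsilon> a) = ev (inv S' \<omega>) (S (act_left \<upsilon> a))"
    by (simp add: S'_inv flip: ev_antipode)
  also have "\<dots> = ev (inv S' \<upsilon> * inv S' \<omega>) (S a)"
    by (simp add: act_left_def S_inv ev_act_right)
  also have "\<dots> = ev (\<omega> * \<upsilon>) a"
    by (simp add: dual.antipode_mult S'_inv flip: ev_antipode)
  finally show ?thesis .
qed

definition translate_left :: "'a \<Rightarrow> 'd \<Rightarrow> 'd" where
  "translate_left b \<omega> = inv_into UNIV ev (\<lambda>a. ev \<omega> (a * b))"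

lemma translate_left_dual_elem: "translate_left b (dual_elem c) = dual_elem (b * c)"
  by (simp add: translate_left_def dual_elem_def[of "b * c"] mult.assoc)

lemma ev_translate_left: "ev (translate_left b \<omega>) a = ev \<omega> (a * b)"
proof -
  obtain c where "\<omega> = dual_elem c" by (rule dual_elem_cases)
  then show ?thesis by (simp add: translate_left_dual_elem mult.assoc)
qed

definition translate_right :: "'d \<Rightarrow> 'a \<Rightarrow> 'd" where
  "translate_right \<omega> b = S' (translate_left (S b) (inv S' \<omega>))"

lemma ev_translate_right: "ev (translate_right \<omega> b) a = ev \<omega> (b * a)"
proof -
  have "ev (translate_right \<omega> b) a = ev (inv S' \<omega>) (S (b * a))"
    by (simp add: translate_right_def ev_antipode ev_translate_left antipode_mult)
  also have "\<dots> = ev \<omega> (b * a)" by (simp add: S'_inv flip: ev_antipode)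
  finally show ?thesis .
qed

lemma span_translate_left:
  assumes V: "cvec.subspace V" and gen: "\<And>b \<omega>. translate_left b \<omega> \<in> V"
  shows "\<omega> \<in> V"
proof -
  obtain c where c: "\<omega> = dual_elem c" by (rule dual_elem_cases)
  have "c \<in> {c. dual_elem c \<in> V}"
    by (rule subspace_of_span_UNIV[OF span_products subspace_vimage[OF clinear_dual_elem V]])
      (auto simp: gen simp flip: translate_left_dual_elem)
  then show ?thesis by (simp add: c)
qed

lemma clinear_inv_antipode: "clinear (inv S)"
  by (rule clinearI; rule injD[OF bij_is_inj[OF bij_antipode]])
    (simp_all add: S_inv clinearD[OF clinear_antipode])

lemma unital_actions:
  shows "unital_right_action act_right" and "unital_left_action act_left"
    and "unital_left_action translate_left" and "unital_right_action translate_right"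
proof -
  have P: "cbilinear ev" and P': "cbilinear (\<lambda>a \<omega>. ev \<omega> a)"
    by (intro cbilinearI clinearI; simp add: ev_add ev_scale clinearD[OF clinear_ev_left])+
  have sep': "\<upsilon> = \<omega>" if "\<And>a. ev \<upsilon> a = ev \<omega> a" for \<upsilon> \<omega>
    using that by (intro ev_inj) auto
  show "unital_right_action act_right"
    by (rule unital_right_action_by_adjunction[OF P ev_eqI ev_act_right span_act_right])
  show "unital_left_action act_left"
  proof (rule unital_left_action_by_adjunction[OF P ev_eqI ev_act_left])
    fix V and a :: 'a assume V: "cvec.subspace V" and gen: "\<And>u a. act_left u a \<in> V"
    have "S a \<in> {a. inv S a \<in> V}"
    proof (rule span_act_right[OF subspace_vimage[OF clinear_inv_antipode V]])
      fix b \<upsilon> show "act_right b \<upsilon> \<in> {a. inv S a \<in> V}"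
        using gen[of "S' \<upsilon>" "inv S b"] by (simp add: act_left_def S_inv S'_inv)
    qed
    then show "a \<in> V" by (simp add: S_inv)
  qed
  show "unital_left_action translate_left"
    by (rule unital_left_action_by_adjunction[OF P' sep' ev_translate_left span_translate_left])
  show "unital_right_action translate_right"
  proof (rule unital_right_action_by_adjunction[OF P' sep' ev_translate_right])
    fix V and \<omega> :: 'd assume V: "cvec.subspace V" and gen: "\<And>\<omega> b. translate_right \<omega> b \<in> V"
    have "inv S' \<omega> \<in> {\<omega>. S' \<omega> \<in> V}"
    proof (rule span_translate_left[OF subspace_vimage[OF dual.clinear_antipode V]])
      fix b \<upsilon> show "translate_left b \<upsilon> \<in> {\<omega>. S' \<omega> \<in> V}"
        using gen[of "S' \<upsilon>" "inv S b"] by (simp add: translate_right_def S_inv S'_inv)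
    qed
    then show "\<omega> \<in> V" by (simp add: S'_inv)
  qed
qed

lemma admissible: "admissible_pairing (\<lambda>a \<omega>. ev \<omega> a)"
  unfolding admissible_pairing_def
proof (intro conjI exI[of _ act_right] exI[of _ act_left] exI[of _ translate_left]
    exI[of _ translate_right])
  show "cbilinear (\<lambda>a \<omega>. ev \<omega> a)"
    by (intro cbilinearI clinearI; simp add: ev_add ev_scale clinearD[OF clinear_ev_left])
  show "\<forall>a. (\<forall>\<omega>. ev \<omega> a = 0) \<longrightarrow> a = 0" using ev_separates by blast
  have "\<omega> = 0" if "\<forall>a. ev \<omega> a = 0" for \<omega>
    using that by (intro ev_inj) (auto simp: clinear_0[OF clinear_ev])
  then show "\<forall>\<omega>. (\<forall>a. ev \<omega> a = 0) \<longrightarrow> \<omega> = 0" by blast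
qed (auto simp: unital_actions ev_act_right ev_act_left ev_translate_left ev_translate_right)

section \<open>Base algebras and densities of the pairing\<close>

text \<open>
  In terms of \<open>\<eta>\<^sub>B\<close> and \<open>\<eta>\<^sub>C\<close> the actions of the base algebras on the dual are already transposes of
  the actions on \<open>A\<close>; the only new fact is the action of \<open>S'\<close> on them, namely
  \<open>S'(\<eta>\<^sub>C(y)) = \<eta>\<^sub>B(t\<^sub>C(y))\<close> and \<open>S'(\<eta>\<^sub>B(x)) = \<eta>\<^sub>C(t\<^sub>B(x))\<close>. Both are transposed forms of the rules for
  \<open>S(xa)\<close>, \<open>S(ax)\<close>, \<open>S(ya)\<close> and \<open>S(ay)\<close>.
\<close>

lemma base_isomorphisms:
  "\<exists>\<alpha> \<beta>. anti_isomorphism B (base_B A') \<alpha> \<and> anti_isomorphism C (base_C A') \<beta> \<and>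
     (\<forall>x\<in>B. \<forall>a \<omega>. ev \<omega> (a \<lhd> x) = ev (\<omega> \<lhd> \<alpha> x) a \<and> ev \<omega> (x \<rhd> a) = ev (\<omega> \<lhd> S_ext A' (\<alpha> x)) a) \<and>
     (\<forall>y\<in>C. \<forall>a \<omega>. ev \<omega> (y \<rhd> a) = ev (\<beta> y \<rhd> \<omega>) a \<and> ev \<omega> (a \<lhd> y) = ev (S_ext A' (\<beta> y) \<rhd> \<omega>) a)"
proof -
  obtain \<eta>\<^sub>B \<eta>\<^sub>C where hom: "injective_homomorphism B \<eta>\<^sub>B" "injective_homomorphism C \<eta>\<^sub>C"
    and \<eta>B: "\<forall>x\<in>B. \<forall>\<omega>. ev (\<omega> \<lhd> \<eta>\<^sub>B x) = (\<lambda>a. ev \<omega> (x \<rhd> a)) \<and>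
           ev (\<eta>\<^sub>B x \<rhd> \<omega>) = (\<lambda>a. ev \<omega> (inv_into C (S_C M) x \<rhd> a))"
    and \<eta>C: "\<forall>y\<in>C. \<forall>\<omega>. ev (\<omega> \<lhd> \<eta>\<^sub>C y) = (\<lambda>a. ev \<omega> (a \<lhd> inv_into B (S_B M) y)) \<and>
           ev (\<eta>\<^sub>C y \<rhd> \<omega>) = (\<lambda>a. ev \<omega> (a \<lhd> y))"
    and bases: "base_B A' = \<eta>\<^sub>C ` C" "base_C A' = \<eta>\<^sub>B ` B"
    using dual_bases by (elim exE conjE) (rule that; assumption)
  have act_B: "ev (\<omega> \<lhd> \<eta>\<^sub>B x) a = ev \<omega> (x \<rhd> a)" "ev (\<eta>\<^sub>B x \<rhd> \<omega>) a = ev \<omega> (t_B M x \<rhd> a)"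
    if "x \<in> B" for x \<omega> a using \<eta>B that by (simp_all add: inv_into_S_C)
  have act_C: "ev (\<omega> \<lhd> \<eta>\<^sub>C y) a = ev \<omega> (a \<lhd> t_C M y)" "ev (\<eta>\<^sub>C y \<rhd> \<omega>) a = ev \<omega> (a \<lhd> y)"
    if "y \<in> C" for y \<omega> a using \<eta>C that by (simp_all add: inv_into_S_B)
  have surj: "surj S'" using dual.bij_antipode by (rule bij_is_surj)
  have S'_C: "S_ext A' (\<eta>\<^sub>C y) = \<eta>\<^sub>B (t_C M y)" if y: "y \<in> C" for y
    unfolding S_ext_def
    by (rule anti_extension_eq[OF surj]; rule ev_inj; rule ext)
      (simp_all add: ev_antipode act_B act_C antipode_actions base_maps_in base_maps_inverse y)
  have S'_B: "S_ext A' (\<eta>\<^sub>B x) = \<eta>\<^sub>C (t_B M x)" if x: "x \<in> B" for x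
    unfolding S_ext_def
    by (rule anti_extension_eq[OF surj]; rule ev_inj; rule ext)
      (simp_all add: ev_antipode act_B act_C antipode_actions base_maps_in base_maps_inverse x)
  have comp: "anti_isomorphism D (h ` E) (\<lambda>x. h (s x))"
    if s: "anti_isomorphism D E s" and h: "injective_homomorphism E h"
    for D :: "'a multiplier set" and E :: "'a multiplier set" and s and h :: "'a multiplier \<Rightarrow> 'd multiplier"
  proof -
    have "bij_betw (h \<circ> s) D (h ` E)"
      using s h by (intro bij_betw_trans[of s D E])
        (auto simp: anti_isomorphism_def injective_homomorphism_def bij_betw_def)
    moreover have "s x \<in> E" if "x \<in> D" for x
      using s that by (auto simp: anti_isomorphism_def dest: bij_betw_apply)
    ultimately show ?thesis
      using s h
      by (simp add: anti_isomorphism_def injective_homomorphism_def linear_on_def comp_def)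
  qed
  show ?thesis
  proof (rule exI[of _ "\<lambda>x. \<eta>\<^sub>C (S_B M x)"], rule exI[of _ "\<lambda>y. \<eta>\<^sub>B (S_C M y)"],
      intro conjI ballI allI)
    show "anti_isomorphism B (base_B A') (\<lambda>x. \<eta>\<^sub>C (S_B M x))"
      unfolding bases by (rule comp[OF anti_S_B hom(2)])
    show "anti_isomorphism C (base_C A') (\<lambda>y. \<eta>\<^sub>B (S_C M y))"
      unfolding bases by (rule comp[OF anti_S_C hom(1)])
  qed (simp_all add: act_B act_C S'_B S'_C base_maps_in base_maps_inverse)
qed

lemma mu_C_S_ext: "y \<in> C \<Longrightarrow> mu_B M (S_ext M y) = mu_C M y"
  by (simp add: mu_C_eq S_ext_C)

lemma densities:
  "left_density B (mu_B M) (\<lambda>a \<omega>. ev \<omega> a) a \<omega> = fac_lB M (ev \<omega>) a"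
  "right_density B (mu_B M) (\<lambda>a \<omega>. ev \<omega> a) a \<omega> = fac_rB M (ev \<omega>) a"
  "left_density C (\<lambda>y. mu_B M (S_ext M y)) (\<lambda>a \<omega>. ev \<omega> a) a \<omega> = fac_lC M (ev \<omega>) a"
  "right_density C (\<lambda>y. mu_B M (S_ext M y)) (\<lambda>a \<omega>. ev \<omega> a) a \<omega> = fac_rC M (ev \<omega>) a"
  by (rule left_density_eq[OF faithful_mu_B subalgebra_B left_factors(1) refl],
      rule right_density_eq[OF faithful_mu_B subalgebra_B right_factors(1) refl],
      rule left_density_eq[OF faithful_mu_C subalgebra_C left_factors(2)], erule mu_C_S_ext,
      rule right_density_eq[OF faithful_mu_C subalgebra_C right_factors(2)], erule mu_C_S_ext)

lemma factor_in:
  "fac_lB M (ev \<omega>) a \<in> B" "fac_rB M (ev \<omega>) a \<in> B" "fac_lC M (ev \<omega>) a \<in> C" "fac_rC M (ev \<omega>) a \<in> C"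
  using left_factors[of \<omega>] right_factors[of \<omega>] by (auto simp: is_left_factor_def is_right_factor_def)

lemma pairing: "multiplier_hopf_algebroid_pairing M A' (mu_B M) (\<lambda>a \<omega>. ev \<omega> a)"
  unfolding multiplier_hopf_algebroid_pairing_def Let_def densities
proof (intro conjI ballI allI)
  show "mu_B M (x\<^sub>1 * x) = mu_B M (S_ext M (S_ext M x) * x\<^sub>1)" if "x\<^sub>1 \<in> B" "x \<in> B" for x\<^sub>1 x
    using that by (rule mu_B_modular[rotated])
  show "\<exists>x\<^sub>1\<in>B. \<forall>x\<in>B. ev \<omega> (x \<rhd> a) = mu_B M (x * x\<^sub>1)" for a \<omega>
    using left_factors(1)[of \<omega>] by (intro bexI[of _ "fac_lB M (ev \<omega>) a"]) (auto simp: is_left_factor_def)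
  show "\<exists>x\<^sub>2\<in>B. \<forall>x\<in>B. ev \<omega> (a \<lhd> x) = mu_B M (x\<^sub>2 * x)" for a \<omega>
    using right_factors(1)[of \<omega>] by (intro bexI[of _ "fac_rB M (ev \<omega>) a"]) (auto simp: is_right_factor_def)
  have "S_ext M (fac_lB M (ev \<upsilon>) p) * fac_lC M (ev \<omega>) q \<in> C"
    "fac_rC M (ev \<upsilon>) p * fac_lC M (ev \<omega>) q \<in> C" for p q \<upsilon> \<omega>
    by (simp_all add: S_ext_B factor_in base_maps_in mult_C)
  note C = this[THEN mu_C_S_ext]
  show "transposes K (ker_lowB_upB A') (canonical_T1 M) (canonical_T2 A')
     (\<lambda>a b a' b'. mu_B M (S_ext M (S_ext M (fac_lB M (ev a') a) * fac_lC M (ev b') b)))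
     (\<lambda>a b a' b'. mu_B M (fac_rB M (ev a') a * fac_lB M (ev b') b))"
    unfolding C by (rule transposes_T1)
  show "transposes (ker_lowB_upB M) (ker_upC_lowC A') (canonical_T2 M) (canonical_T1 A')
     (\<lambda>a b a' b'. mu_B M (fac_rB M (ev a') a * S_ext M (fac_rC M (ev b') b)))
     (\<lambda>a b a' b'. mu_B M (S_ext M (fac_rC M (ev a') a * fac_lC M (ev b') b)))"
    unfolding C by (rule transposes_T2)
qed (rule regular regular_dual faithful_mu_B admissible base_isomorphisms ev_antipode[symmetric])+

end

theorem theorem5p10:
  fixes M :: "'a::complex_algebra measured_hopf_algebroid"
    and A' :: "'d::complex_algebra hopf_algebroid"
    and ev :: "'d \<Rightarrow> 'a \<Rightarrow> complex"
  assumes "measured_regular_multiplier_hopf_algebroid M"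
    and "is_dual M A' ev"
  shows "multiplier_hopf_algebroid_pairing M A' (mu_B M) (\<lambda>a \<omega>. ev \<omega> a)"
proof -
  interpret dual_hopf_algebroid M A' ev
    using assms by unfold_locales
  show ?thesis by (rule pairing)
qed

end
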